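(* Let $K$ be a commutative ring with unit, $\lambda\in K$, $X$ a set, $\Omega=\{P,D\}$ with $P,D$ unary operator symbols, and let $S\subseteq K[X;\Omega]$ be the set consisting of the following elements, for all $u,v\in\mathcal{Q}(X)$: 1. $P(u)P(v)-P(uP(v))-P(P(u)v)-\lambda P(uv)$; 2. $D(uv)-D(u)v-uD(v)-\lambda D(u)D(v)$; 3. $D(P(u))-u$. Then $K[X;\Omega|S]=K[X;\Omega]/Id(S)$ is a free commutative $\lambda$-differential Rota-Baxter algebra on the set $X$, with a $K$-basis $\Upsilon(D^{\omega}(X))$ (that is, the images of the elements of $\Upsilon(D^\omega(X))$ form a $K$-basis).
   Context: Algebras are associative and not necessarily unital. A commutative $\lambda$-differential Rota-Baxter algebra is a commutative $K$-algebra $R$ with two $K$-linear operators $P,D:R\to R$ such that for all $u,v\in R$: $P(u)P(v)=P(uP(v))+P(P(u)v)+\lambda P(uv)$; $D(uv)=D(u)v+uD(v)+\lambda D(u)D(v)$; and $D(P(u))=u$. Morphisms are $K$-algebra homomorphisms commuting with $P$ and $D$, and "free on $X$" is meant with respect to the canonical map from $X$. For a set $Y$, $CS(Y)$ is the free commutative semigroup on $Y$ (nonempty commutative words). Put $\mathcal{Q}_0=CS(X)$, $\mathcal{Q}_n=CS(X\cup\{P(u),D(u)\mid u\in\mathcal{Q}_{n-1}\})$ for $n\ge1$ (with $P(u),D(u)$ formal expressions), and $\mathcal{Q}(X)=\bigcup_{n\ge0}\mathcal{Q}_n$. $K[X;\Omega]$ is the commutative $K$-algebra with $K$-basis $\mathcal{Q}(X)$,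 with $P$ and $D$ extended $K$-linearly. $Id(S)$ is the smallest ideal of $K[X;\Omega]$ containing $S$ and closed under $P$ and $D$; the quotient carries the induced operators. Let $D^\omega(X)=\{D^i(x)\mid i\ge0,\ x\in X\}$ with $D^0(x)=x$. Define $\Upsilon_0=CS(D^\omega(X))$ and, for $n\ge1$, $\Upsilon_n=\Upsilon_0\cup P(\Upsilon_{n-1})\cup\Upsilon_0P(\Upsilon_{n-1})$, where $P(\Upsilon_{n-1})=\{P(v)\mid v\in\Upsilon_{n-1}\}$ and $\Upsilon_0P(\Upsilon_{n-1})=\{uP(v)\mid u\in\Upsilon_0,\ v\in\Upsilon_{n-1}\}$. Put $\Upsilon(D^\omega(X))=\bigcup_{n\ge0}\Upsilon_n\subseteq\mathcal{Q}(X)$. *)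

theory Defs
  imports
    "HOL-Library.Multiset"
    "HOL-Library.Poly_Mapping"
    "HOL-Algebra.Module"
    "HOL-Algebra.QuotRing"
begin

section \<open>Commutative algebras with two linear operators\<close>

text \<open>
  Algebras need not be unital. The inherited field \<^const>\<open>one\<close> of the record carries no information:
  no definition below refers to the unit of an algebra, and morphisms need not preserve it.
\<close>

record ('k, 'a) op_algebra = "('k, 'a) module" +
  opP :: "'a \<Rightarrow> 'a"
  opD :: "'a \<Rightarrow> 'a"

locale comm_op_algebra = Module.module K A
  for K :: "'k ring" and A :: "('k, 'a) op_algebra" (structure) +
  assumes mult_closed: "\<lbrakk>u \<in> carrier A; v \<in> carrier A\<rbrakk> \<Longrightarrow> u \<otimes> v \<in> carrier A"
    and mult_assoc: "\<lbrakk>u \<in> carrier A; v \<in> carrier A; w \<in> carrier A\<rbrakk> \<Longrightarrow> (u \<otimes> v) \<otimes> w = u \<otimes> (v \<otimes> w)"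
    and mult_comm: "\<lbrakk>u \<in> carrier A; v \<in> carrier A\<rbrakk> \<Longrightarrow> u \<otimes> v = v \<otimes> u"
    and mult_add_left: "\<lbrakk>u \<in> carrier A; v \<in> carrier A; w \<in> carrier A\<rbrakk> \<Longrightarrow>
          (u \<oplus> v) \<otimes> w = (u \<otimes> w) \<oplus> (v \<otimes> w)"
    and mult_smult_left: "\<lbrakk>c \<in> carrier K; u \<in> carrier A; v \<in> carrier A\<rbrakk> \<Longrightarrow>
          (c \<odot> u) \<otimes> v = c \<odot> (u \<otimes> v)"
    and opP_closed: "u \<in> carrier A \<Longrightarrow> opP A u \<in> carrier A"
    and opP_add: "\<lbrakk>u \<in> carrier A; v \<in> carrier A\<rbrakk> \<Longrightarrow> opP A (u \<oplus> v) = opP A u \<oplus> opP A v"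
    and opP_smult: "\<lbrakk>c \<in> carrier K; u \<in> carrier A\<rbrakk> \<Longrightarrow> opP A (c \<odot> u) = c \<odot> opP A u"
    and opD_closed: "u \<in> carrier A \<Longrightarrow> opD A u \<in> carrier A"
    and opD_add: "\<lbrakk>u \<in> carrier A; v \<in> carrier A\<rbrakk> \<Longrightarrow> opD A (u \<oplus> v) = opD A u \<oplus> opD A v"
    and opD_smult: "\<lbrakk>c \<in> carrier K; u \<in> carrier A\<rbrakk> \<Longrightarrow> opD A (c \<odot> u) = c \<odot> opD A u"

locale diff_rota_baxter_algebra = comm_op_algebra K A
  for K :: "'k ring" and lam :: 'k and A :: "('k, 'a) op_algebra" (structure) +
  assumes weight_closed: "lam \<in> carrier K"
    and rota_baxter: "\<lbrakk>u \<in> carrier A; v \<in> carrier A\<rbrakk> \<Longrightarrow>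
          opP A u \<otimes> opP A v = opP A (u \<otimes> opP A v) \<oplus> opP A (opP A u \<otimes> v) \<oplus> lam \<odot> opP A (u \<otimes> v)"
    and leibniz: "\<lbrakk>u \<in> carrier A; v \<in> carrier A\<rbrakk> \<Longrightarrow>
          opD A (u \<otimes> v) = (opD A u \<otimes> v) \<oplus> (u \<otimes> opD A v) \<oplus> lam \<odot> (opD A u \<otimes> opD A v)"
    and opD_opP: "u \<in> carrier A \<Longrightarrow> opD A (opP A u) = u"

definition op_algebra_hom ::
    "'k ring \<Rightarrow> ('k, 'a) op_algebra \<Rightarrow> ('k, 'b) op_algebra \<Rightarrow> ('a \<Rightarrow> 'b) set" where
  "op_algebra_hom K A B = {h. h \<in> hom A B \<and> h \<in> hom (add_monoid A) (add_monoid B)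
     \<and> (\<forall>c\<in>carrier K. \<forall>u\<in>carrier A. h (c \<odot>\<^bsub>A\<^esub> u) = c \<odot>\<^bsub>B\<^esub> h u)
     \<and> (\<forall>u\<in>carrier A. h (opP A u) = opP B (h u))
     \<and> (\<forall>u\<in>carrier A. h (opD A u) = opD B (h u))}"

text \<open>
  Freeness with respect to the map \<open>\<eta>\<close> from \<open>X\<close>. The first argument fixes the type of which the
  carriers of the test algebras are subsets. Morphisms matter only on the carrier, hence the use of
  \<^const>\<open>extensional\<close> in the uniqueness statement.
\<close>

definition free_diff_rota_baxter_algebra ::
    "'b itself \<Rightarrow> 'k ring \<Rightarrow> 'k \<Rightarrow> 'x set \<Rightarrow> ('k, 'a) op_algebra \<Rightarrow> ('x \<Rightarrow> 'a) \<Rightarrow> bool" where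
  "free_diff_rota_baxter_algebra T K lam X A \<eta> \<longleftrightarrow>
     diff_rota_baxter_algebra K lam A \<and> \<eta> \<in> X \<rightarrow> carrier A \<and>
     (\<forall>(R :: ('k, 'b) op_algebra) f.
        diff_rota_baxter_algebra K lam R \<and> f \<in> X \<rightarrow> carrier R \<longrightarrow>
        (\<exists>!h. h \<in> extensional (carrier A) \<and> h \<in> op_algebra_hom K A R \<and> (\<forall>x\<in>X. h (\<eta> x) = f x)))"

text \<open>Bases are families, so that two indices with the same image violate independence.\<close>

definition basis_family :: "'k ring \<Rightarrow> ('k, 'a) op_algebra \<Rightarrow> 'i set \<Rightarrow> ('i \<Rightarrow> 'a) \<Rightarrow> bool" where
  "basis_family K A I b \<longleftrightarrow>
     b \<in> I \<rightarrow> carrier A \<and>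
     (\<forall>F c. finite F \<and> F \<subseteq> I \<and> c \<in> F \<rightarrow> carrier K \<and> (\<Oplus>\<^bsub>A\<^esub>i\<in>F. c i \<odot>\<^bsub>A\<^esub> b i) = \<zero>\<^bsub>A\<^esub>
        \<longrightarrow> (\<forall>i\<in>F. c i = \<zero>\<^bsub>K\<^esub>)) \<and>
     (\<forall>a\<in>carrier A. \<exists>F c. finite F \<and> F \<subseteq> I \<and> c \<in> F \<rightarrow> carrier K \<and> a = (\<Oplus>\<^bsub>A\<^esub>i\<in>F. c i \<odot>\<^bsub>A\<^esub> b i))"

definition op_ideal :: "'k ring \<Rightarrow> ('k, 'a) op_algebra \<Rightarrow> 'a set \<Rightarrow> bool" where
  "op_ideal K A I \<longleftrightarrow> submodule I K A
     \<and> (\<forall>a\<in>carrier A. \<forall>i\<in>I. a \<otimes>\<^bsub>A\<^esub> i \<in> I \<and> i \<otimes>\<^bsub>A\<^esub> a \<in> I)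
     \<and> (\<forall>i\<in>I. opP A i \<in> I) \<and> (\<forall>i\<in>I. opD A i \<in> I)"

definition op_ideal_generated :: "'k ring \<Rightarrow> ('k, 'a) op_algebra \<Rightarrow> 'a set \<Rightarrow> 'a set" where
  "op_ideal_generated K A S = \<Inter>{I. op_ideal K A I \<and> S \<subseteq> I}"

text \<open>
  The ring part is that of \<^const>\<open>FactRing\<close>; scalars and operators act on a coset through its
  representatives.
\<close>

definition op_quotient :: "('k, 'a) op_algebra \<Rightarrow> 'a set \<Rightarrow> ('k, 'a set) op_algebra" where
  "op_quotient A I =
     \<lparr>carrier = a_rcosets\<^bsub>A\<^esub> I, mult = rcoset_mult A I, one = I +>\<^bsub>A\<^esub> \<one>\<^bsub>A\<^esub>, zero = I, add = set_add A,
      smult = (\<lambda>c C. \<Union>a\<in>C. I +>\<^bsub>A\<^esub> (c \<odot>\<^bsub>A\<^esub> a)),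
      opP = (\<lambda>C. \<Union>a\<in>C. I +>\<^bsub>A\<^esub> opP A a),
      opD = (\<lambda>C. \<Union>a\<in>C. I +>\<^bsub>A\<^esub> opD A a)\<rparr>"


section \<open>The words \<open>\<Q>(X)\<close> and the algebra \<open>K[X;\<Omega>]\<close>\<close>

text \<open>
  A letter is a generator or a formal expression \<open>P(u)\<close> or \<open>D(u)\<close>. A commutative word is the multiset
  of its letters, so concatenation of words is \<open>+\<close>. The empty multiset is not a word; it is excluded
  by \<open>CS\<close>.
\<close>

datatype 'x letter = Gen 'x | LP "'x letter multiset" | LD "'x letter multiset"

type_synonym 'x word = "'x letter multiset"

definition CS :: "'a set \<Rightarrow> 'a multiset set" where
  "CS Y = {w. w \<noteq> {#} \<and> set_mset w \<subseteq> Y}"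

primrec \<Q>_level :: "'x set \<Rightarrow> nat \<Rightarrow> 'x word set" where
  "\<Q>_level X 0 = CS (Gen ` X)"
| "\<Q>_level X (Suc n) = CS (Gen ` X \<union> LP ` \<Q>_level X n \<union> LD ` \<Q>_level X n)"

definition \<Q> :: "'x set \<Rightarrow> 'x word set" where
  "\<Q> X = (\<Union>n. \<Q>_level X n)"

text \<open>
  The sort \<open>{comm_ring, comm_monoid_mult}\<close> is that of commutative rings with unit; in contrast to
  \<^class>\<open>comm_ring_1\<close> it does not exclude the zero ring.
\<close>

definition scalar_ring :: "'k::{comm_ring, comm_monoid_mult} ring" where
  "scalar_ring = \<lparr>carrier = UNIV, mult = (*), one = 1, zero = 0, add = (+)\<rparr>"

definition scale :: "'k \<Rightarrow> ('w \<Rightarrow>\<^sub>0 'k) \<Rightarrow> ('w \<Rightarrow>\<^sub>0 'k::{comm_ring, comm_monoid_mult})" where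
  "scale c = Poly_Mapping.map ((*) c)"

definition linear_extension ::
    "('v \<Rightarrow> 'w) \<Rightarrow> ('v \<Rightarrow>\<^sub>0 'k) \<Rightarrow> ('w \<Rightarrow>\<^sub>0 'k::{comm_ring, comm_monoid_mult})" where
  "linear_extension g f = (\<Sum>w\<in>Poly_Mapping.keys f. Poly_Mapping.single (g w) (Poly_Mapping.lookup f w))"

definition extP :: "('x word \<Rightarrow>\<^sub>0 'k) \<Rightarrow> ('x word \<Rightarrow>\<^sub>0 'k::{comm_ring, comm_monoid_mult})" where
  "extP = linear_extension (\<lambda>u. {#LP u#})"

definition extD :: "('x word \<Rightarrow>\<^sub>0 'k) \<Rightarrow> ('x word \<Rightarrow>\<^sub>0 'k::{comm_ring, comm_monoid_mult})" where
  "extD = linear_extension (\<lambda>u. {#LD u#})"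

text \<open>
  Multiplication of \<^typ>\<open>'x word \<Rightarrow>\<^sub>0 'k\<close> is convolution along \<open>+\<close>, i.e. the bilinear extension of
  concatenation. The unit \<open>single {#} 1\<close> of the ambient type lies outside the carrier.
\<close>

definition free_op_algebra ::
    "'x set \<Rightarrow> ('k::{comm_ring, comm_monoid_mult}, 'x word \<Rightarrow>\<^sub>0 'k) op_algebra" where
  "free_op_algebra X =
     \<lparr>carrier = {f. Poly_Mapping.keys f \<subseteq> \<Q> X}, mult = (*), one = undefined, zero = 0, add = (+),
      smult = scale, opP = extP, opD = extD\<rparr>"

definition word_mon :: "'x word \<Rightarrow> ('x word \<Rightarrow>\<^sub>0 'k::{comm_ring, comm_monoid_mult})" where
  "word_mon w = Poly_Mapping.single w 1"


section \<open>The relations and the words \<open>\<Upsilon>(D\<^sup>\<omega>(X))\<close>\<close>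

definition drb_relations ::
    "'k::{comm_ring, comm_monoid_mult} \<Rightarrow> 'x set \<Rightarrow> ('x word \<Rightarrow>\<^sub>0 'k) set" where
  "drb_relations lam X =
     {extP (word_mon u) * extP (word_mon v)
        - extP (word_mon u * extP (word_mon v)) - extP (extP (word_mon u) * word_mon v)
        - scale lam (extP (word_mon u * word_mon v)) | u v. u \<in> \<Q> X \<and> v \<in> \<Q> X} \<union>
     {extD (word_mon u * word_mon v)
        - extD (word_mon u) * word_mon v - word_mon u * extD (word_mon v)
        - scale lam (extD (word_mon u) * extD (word_mon v)) | u v. u \<in> \<Q> X \<and> v \<in> \<Q> X} \<union>
     {extD (extP (word_mon u)) - word_mon u | u. u \<in> \<Q> X}"

definition drb_ideal ::
    "'k::{comm_ring, comm_monoid_mult} \<Rightarrow> 'x set \<Rightarrow> ('x word \<Rightarrow>\<^sub>0 'k) set" where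
  "drb_ideal lam X = op_ideal_generated scalar_ring (free_op_algebra X) (drb_relations lam X)"

definition drb_quotient ::
    "'k::{comm_ring, comm_monoid_mult} \<Rightarrow> 'x set \<Rightarrow> ('k, ('x word \<Rightarrow>\<^sub>0 'k) set) op_algebra" where
  "drb_quotient lam X = op_quotient (free_op_algebra X) (drb_ideal lam X)"

definition word_class ::
    "'k::{comm_ring, comm_monoid_mult} \<Rightarrow> 'x set \<Rightarrow> 'x word \<Rightarrow> ('x word \<Rightarrow>\<^sub>0 'k) set" where
  "word_class lam X w = drb_ideal lam X +>\<^bsub>free_op_algebra X\<^esub> word_mon w"

definition D_power :: "nat \<Rightarrow> 'x \<Rightarrow> 'x letter" where
  "D_power i x = ((\<lambda>l. LD {#l#}) ^^ i) (Gen x)"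

definition D_omega :: "'x set \<Rightarrow> 'x letter set" where
  "D_omega X = {D_power i x | i x. x \<in> X}"

primrec \<Upsilon>_level :: "'x set \<Rightarrow> nat \<Rightarrow> 'x word set" where
  "\<Upsilon>_level X 0 = CS (D_omega X)"
| "\<Upsilon>_level X (Suc n) = CS (D_omega X) \<union> {{#LP v#} | v. v \<in> \<Upsilon>_level X n} \<union>
     {u + {#LP v#} | u v. u \<in> CS (D_omega X) \<and> v \<in> \<Upsilon>_level X n}"

definition \<Upsilon> :: "'x set \<Rightarrow> 'x word set" where
  "\<Upsilon> X = (\<Union>n. \<Upsilon>_level X n)"

end

theory Submission
  imports Defs "HOL-Library.Function_Algebras"
begin

text \<open>
  Every element of a differential Rota--Baxter algebra generated by \<open>X\<close> is a linear combination of
  values of words in \<open>\<Upsilon>(D\<^sup>\<omega>(X))\<close>: the Rota--Baxter identity merges two factors \<open>P(u)\<close>,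
  \<open>P(v)\<close> into one while lowering the total nesting depth of the products that remain, and the
  Leibniz rule together with \<open>D(P(u)) = u\<close> moves \<open>D\<close> down to the generators.

  Independence is not obtained by rewriting but from a model. The quasi-shuffle algebra on an alphabet
  of commutative words, tensored with the words themselves, is a (completed) free commutative
  Rota--Baxter algebra in which \<open>u\<^sub>0 P(u\<^sub>1 P(\<dots>))\<close> becomes the basis vector
  \<open>u\<^sub>0 \<otimes> u\<^sub>1 \<otimes> \<dots>\<close>. The series over it with the \<open>\<lambda>\<close>-Hurwitz product carry the shift as a derivation \<open>D\<close>,
  and \<open>P\<close> lifts to a Rota--Baxter operator with \<open>D \<circ> P = id\<close>. Sending \<open>x\<close> to a series with
  independent coefficients \<open>x\<^sub>0, x\<^sub>1, \<dots>\<close>, the constant terms of distinct words of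
  \<open>\<Upsilon>(D\<^sup>\<omega>(X))\<close> are distinct basis vectors.
\<close>

section \<open>Words and their evaluation\<close>

text \<open>The obstacle for a model is to have both operators at once. If \<open>D\<close> is a
  shift of series, an operator \<open>P\<close> with \<open>D(P(f)) = f\<close> can only put a new
  constant term in front of \<open>f\<close>. When that term is a Rota-Baxter operator of the
  coefficients applied to the constant term of \<open>f\<close>, the Rota-Baxter identity holds at
  constant terms, and its derivative is an instance of the weighted Leibniz rule. So every
  commutative Rota-Baxter algebra of coefficients extends. Taking constant terms respects products
  and \<open>P\<close> but forgets \<open>D\<close>, which survives only through the higher
  coefficients assigned to the generators; hence these have to be independent. One product serves
  both layers: its recursion at the empty letter is the Leibniz rule, and its recursion on operators
  that prepend a letter is the Rota-Baxter identity. Nothing is divided, so \<open>K\<close> and the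
  weight are arbitrary, and each letter splits in finitely many ways, so series of unrestricted
  support can be multiplied.\<close>

lemma CS_mono: "Y \<subseteq> Z \<Longrightarrow> CS Y \<subseteq> CS Z"
  by (auto simp: CS_def)

lemma Q_level_Suc: "\<Q>_level X n \<subseteq> \<Q>_level X (Suc n)"
proof (induction n)
  case 0
  then show ?case by (auto simp: CS_def)
next
  case (Suc n)
  then show ?case
    unfolding \<Q>_level.simps(2)[of X n] \<Q>_level.simps(2)[of X "Suc n"]
    by (intro CS_mono Un_mono image_mono order_refl)
qed

lemma Q_level_mono: "m \<le> n \<Longrightarrow> \<Q>_level X m \<subseteq> \<Q>_level X n"
  by (rule lift_Suc_mono_le[of "\<Q>_level X"]) (rule Q_level_Suc)

lemma Q_Gen: "x \<in> X \<Longrightarrow> {#Gen x#} \<in> \<Q> X"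
  by (auto simp: \<Q>_def CS_def intro!: exI[of _ 0])

lemma Q_LP:
  assumes "u \<in> \<Q> X" shows "{#LP u#} \<in> \<Q> X"
proof -
  obtain n where "u \<in> \<Q>_level X n" using assms by (auto simp: \<Q>_def)
  then have "{#LP u#} \<in> \<Q>_level X (Suc n)" by (simp add: CS_def)
  then show ?thesis unfolding \<Q>_def by blast
qed

lemma Q_LD:
  assumes "u \<in> \<Q> X" shows "{#LD u#} \<in> \<Q> X"
proof -
  obtain n where "u \<in> \<Q>_level X n" using assms by (auto simp: \<Q>_def)
  then have "{#LD u#} \<in> \<Q>_level X (Suc n)" by (simp add: CS_def)
  then show ?thesis unfolding \<Q>_def by blast
qed

lemma Q_add:
  assumes "u \<in> \<Q> X" "v \<in> \<Q> X" shows "u + v \<in> \<Q> X"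
proof -
  obtain m n where mn: "u \<in> \<Q>_level X m" "v \<in> \<Q>_level X n"
    using assms by (auto simp: \<Q>_def)
  define k where "k = max m n"
  have "u \<in> \<Q>_level X k" "v \<in> \<Q>_level X k"
    using mn unfolding k_def by (meson Q_level_mono max.cobounded1 max.cobounded2 subsetD)+
  then have "u + v \<in> \<Q>_level X k"
    by (cases k) (auto simp: CS_def)
  then show ?thesis by (auto simp: \<Q>_def)
qed

lemma Q_not_empty: "w \<in> \<Q> X \<Longrightarrow> w \<noteq> {#}"
proof -
  assume "w \<in> \<Q> X"
  then obtain n where "w \<in> \<Q>_level X n" by (auto simp: \<Q>_def)
  then show ?thesis by (cases n) (auto simp: CS_def)
qed

lemma CS_induct [consumes 1, case_names single add]:
  assumes "w \<in> CS Y"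
    and "\<And>y. y \<in> Y \<Longrightarrow> R {#y#}"
    and "\<And>y v. y \<in> Y \<Longrightarrow> v \<in> CS Y \<Longrightarrow> R v \<Longrightarrow> R ({#y#} + v)"
  shows "R w"
  using assms(1)
proof (induction w)
  case (add y v)
  then have y: "y \<in> Y" by (simp add: CS_def)
  show ?case
  proof (cases "v = {#}")
    case False
    with add.prems have v: "v \<in> CS Y" by (auto simp: CS_def)
    then show ?thesis using assms(3)[OF y v add.IH[OF v]] by simp
  qed (use assms(2)[OF y] in simp)
qed (simp add: CS_def)

text \<open>One level step adjoins letters and forms words over them at the same time. Induction on
  the level, and inside it on the word, separates the two, so that later proofs meet one case per
  operation of an operated algebra.\<close>

lemma Q_induct [consumes 1, case_names Gen LP LD add]:
  assumes "w \<in> \<Q> X"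
    and Gen: "\<And>x. x \<in> X \<Longrightarrow> R {#Gen x#}"
    and LP: "\<And>u. u \<in> \<Q> X \<Longrightarrow> R u \<Longrightarrow> R {#LP u#}"
    and LD: "\<And>u. u \<in> \<Q> X \<Longrightarrow> R u \<Longrightarrow> R {#LD u#}"
    and add: "\<And>u v. u \<in> \<Q> X \<Longrightarrow> R u \<Longrightarrow> v \<in> \<Q> X \<Longrightarrow> R v \<Longrightarrow> R (u + v)"
  shows "R w"
proof -
  \<comment> \<open>Membership in \<open>\<Q> X\<close> is carried along because the case
    \<open>add\<close> demands it of both factors.\<close>
  have CS: "R w \<and> w \<in> \<Q> X" if "w \<in> CS Y" and Y: "\<And>y. y \<in> Y \<Longrightarrow> R {#y#} \<and> {#y#} \<in> \<Q> X" for w Y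
    using that(1)
  proof (induction rule: CS_induct)
    case (single y)
    then show ?case by (rule Y)
  next
    case (add y v)
    then show ?case using Y[of y] assms(5)[of "{#y#}" v] Q_add[of "{#y#}" X v] by blast
  qed
  have "R w \<and> w \<in> \<Q> X" if "w \<in> \<Q>_level X n" for n w
    using that
  proof (induction n arbitrary: w)
    case 0
    show ?case
      by (rule CS[OF 0[unfolded \<Q>_level.simps]]) (auto intro: Gen Q_Gen)
  next
    case (Suc n)
    show ?case
      by (rule CS[OF Suc.prems[unfolded \<Q>_level.simps]])
        (auto intro: Gen Q_Gen LP Q_LP LD Q_LD dest: Suc.IH)
  qed
  then show ?thesis using assms(1) by (auto simp: \<Q>_def)
qed

text \<open>
  There is no unit to start a fold with, so \<^const>\<open>None\<close> acts as one. Elements outside the carrier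
  are skipped because \<^const>\<open>fold_mset\<close> needs a step that commutes on the whole type.
\<close>

definition mprod_step :: "('a, 'b) monoid_scheme \<Rightarrow> 'a \<Rightarrow> 'a option \<Rightarrow> 'a option" where
  "mprod_step A x acc = (if x \<in> carrier A \<and> set_option acc \<subseteq> carrier A
     then Some (case acc of None \<Rightarrow> x | Some y \<Rightarrow> x \<otimes>\<^bsub>A\<^esub> y) else acc)"

definition mprod :: "('a, 'b) monoid_scheme \<Rightarrow> 'a multiset \<Rightarrow> 'a" where
  "mprod A M = the (fold_mset (mprod_step A) None M)"

context comm_op_algebra begin

text \<open>The laws of \<open>A\<close> hold only on its carrier. Elsewhere the steps commute
  because an element outside the carrier acts as the identity and an accumulator outside the carrier
  is never changed.\<close>

lemma comp_fun_commute_mprod_step: "comp_fun_commute (mprod_step A)"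
proof
  fix x y
  show "mprod_step A y \<circ> mprod_step A x = mprod_step A x \<circ> mprod_step A y"
  proof
    fix acc
    have "y \<otimes> (x \<otimes> z) = x \<otimes> (y \<otimes> z)" if "x \<in> carrier A" "y \<in> carrier A" "z \<in> carrier A" for z
      using that mult_comm[of x y] by (simp flip: mult_assoc)
    then show "(mprod_step A y \<circ> mprod_step A x) acc = (mprod_step A x \<circ> mprod_step A y) acc"
      using mult_comm[of x y]
      by (cases acc; cases "x \<in> carrier A"; cases "y \<in> carrier A")
        (auto simp: mprod_step_def mult_closed)
  qed
qed

lemma mprod_single: "x \<in> carrier A \<Longrightarrow> mprod A {#x#} = x"
proof -
  interpret comp_fun_commute "mprod_step A" by (rule comp_fun_commute_mprod_step)
  show "x \<in> carrier A \<Longrightarrow> mprod A {#x#} = x"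
    by (simp add: mprod_def mprod_step_def)
qed

lemma mprod_add_mset_closed:
  assumes "set_mset M \<subseteq> carrier A" "M \<noteq> {#}"
  shows "mprod A M \<in> carrier A \<and> (\<forall>x\<in>carrier A. mprod A (add_mset x M) = x \<otimes> mprod A M)"
proof -
  interpret comp_fun_commute "mprod_step A" by (rule comp_fun_commute_mprod_step)
  have "\<exists>y\<in>carrier A. fold_mset (mprod_step A) None M = Some y"
    using assms
  proof (induction M)
    case (add x M)
    then show ?case
      by (cases "M = {#}") (auto simp: mprod_step_def[of _ x] mult_closed)
  qed simp
  then obtain y where "y \<in> carrier A" "fold_mset (mprod_step A) None M = Some y" by blast
  then show ?thesis
    by (auto simp: mprod_def mprod_step_def[of _ _ "Some y"])
qed

lemmas mprod_closed = mprod_add_mset_closed[THEN conjunct1]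

lemma mprod_add:
  assumes "set_mset M \<subseteq> carrier A" "M \<noteq> {#}" "set_mset N \<subseteq> carrier A" "N \<noteq> {#}"
  shows "mprod A (M + N) = mprod A M \<otimes> mprod A N"
  using assms(1,2)
proof (induction M)
  case (add x M)
  show ?case
  proof (cases "M = {#}")
    case True
    then show ?thesis using add.prems assms by (simp add: mprod_add_mset_closed mprod_single)
  next
    case False
    then have "mprod A (add_mset x (M + N)) = x \<otimes> mprod A (M + N)"
      using add.prems assms mprod_add_mset_closed[of "M + N"] by auto
    then show ?thesis using False add assms
      by (simp add: mprod_add_mset_closed mult_assoc)
  qed
qed simp

end

primrec eval_letter :: "('k, 'a) op_algebra \<Rightarrow> ('x \<Rightarrow> 'a) \<Rightarrow> 'x letter \<Rightarrow> 'a" where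
  "eval_letter A f (Gen x) = f x"
| "eval_letter A f (LP w) = opP A (mprod A (image_mset (eval_letter A f) w))"
| "eval_letter A f (LD w) = opD A (mprod A (image_mset (eval_letter A f) w))"

definition eval_word :: "('k, 'a) op_algebra \<Rightarrow> ('x \<Rightarrow> 'a) \<Rightarrow> 'x word \<Rightarrow> 'a" where
  "eval_word A f w = mprod A (image_mset (eval_letter A f) w)"

context comm_op_algebra begin

context
  fixes X :: "'x set" and f
  assumes f: "f \<in> X \<rightarrow> carrier A"
begin

lemma eval_letter_closed_aux:
  "w \<in> \<Q> X \<Longrightarrow> eval_letter A f ` set_mset w \<subseteq> carrier A"
proof (induction rule: Q_induct)
  case (Gen x)
  then show ?case using f by auto
next
  case (LP u)
  then have "eval_word A f u \<in> carrier A"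
    by (simp add: eval_word_def mprod_closed Q_not_empty)
  then show ?case by (simp add: eval_word_def opP_closed)
next
  case (LD u)
  then have "eval_word A f u \<in> carrier A"
    by (simp add: eval_word_def mprod_closed Q_not_empty)
  then show ?case by (simp add: eval_word_def opD_closed)
next
  case (add u v)
  then show ?case by (simp add: image_Un)
qed

lemma eval_word_closed: "w \<in> \<Q> X \<Longrightarrow> eval_word A f w \<in> carrier A"
  by (simp add: eval_word_def mprod_closed Q_not_empty eval_letter_closed_aux)

lemma eval_word_Gen: "x \<in> X \<Longrightarrow> eval_word A f {#Gen x#} = f x"
  using funcset_mem[OF f] by (simp add: eval_word_def mprod_single)

lemma eval_word_LP: "w \<in> \<Q> X \<Longrightarrow> eval_word A f {#LP w#} = opP A (eval_word A f w)"
  using eval_word_closed opP_closed by (auto simp: eval_word_def mprod_single)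

lemma eval_word_LD: "w \<in> \<Q> X \<Longrightarrow> eval_word A f {#LD w#} = opD A (eval_word A f w)"
  using eval_word_closed opD_closed by (auto simp: eval_word_def mprod_single)

lemma eval_word_add: "u \<in> \<Q> X \<Longrightarrow> v \<in> \<Q> X \<Longrightarrow> eval_word A f (u + v) = eval_word A f u \<otimes> eval_word A f v"
  using eval_letter_closed_aux by (simp add: eval_word_def mprod_add Q_not_empty)

end
end

section \<open>Linear combinations and the algebra \<open>K[X;\<Omega>]\<close>\<close>

lemma sum_single_lookup:
  fixes p :: "'w \<Rightarrow>\<^sub>0 'b::comm_monoid_add"
  shows "(\<Sum>w\<in>Poly_Mapping.keys p. Poly_Mapping.single w (Poly_Mapping.lookup p w)) = p"
  by (rule poly_mapping_eqI)
    (auto simp: Poly_Mapping.lookup_sum Poly_Mapping.lookup_single when_def Poly_Mapping.in_keys_iff)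

text \<open>The support stays inside \<open>W\<close> throughout because evaluation obeys its laws
  only on actual words; the type also contains \<open>{#}\<close> and words over foreign
  generators.\<close>

lemma poly_mapping_keys_induct [consumes 1, case_names zero single add]:
  fixes p :: "'w \<Rightarrow>\<^sub>0 'b::comm_monoid_add"
  assumes "Poly_Mapping.keys p \<subseteq> W"
    and "R 0"
    and "\<And>w c. w \<in> W \<Longrightarrow> R (Poly_Mapping.single w c)"
    and add: "\<And>p q. Poly_Mapping.keys p \<subseteq> W \<Longrightarrow> R p \<Longrightarrow> Poly_Mapping.keys q \<subseteq> W \<Longrightarrow> R q \<Longrightarrow> R (p + q)"
  shows "R p"
proof -
  have "R (\<Sum>w\<in>F. Poly_Mapping.single w (Poly_Mapping.lookup p w))
      \<and> Poly_Mapping.keys (\<Sum>w\<in>F. Poly_Mapping.single w (Poly_Mapping.lookup p w)) \<subseteq> W"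
    if "F \<subseteq> W" "finite F" for F
    using that(2,1)
  proof (induction F rule: finite_induct)
    case (insert w F)
    let ?s = "Poly_Mapping.single w (Poly_Mapping.lookup p w)"
    have "Poly_Mapping.keys ?s \<subseteq> W" using insert.prems by auto
    then show ?case
      using insert assms(3)[of w "Poly_Mapping.lookup p w"]
        add[of ?s "\<Sum>w\<in>F. Poly_Mapping.single w (Poly_Mapping.lookup p w)"]
        Poly_Mapping.keys_add[of ?s "\<Sum>w\<in>F. Poly_Mapping.single w (Poly_Mapping.lookup p w)"]
      by auto
  qed (simp add: assms(2))
  from this[OF assms(1) finite_keys] show ?thesis
    by (simp add: sum_single_lookup)
qed

lemma lookup_scale [simp]: "Poly_Mapping.lookup (scale c p) w = c * Poly_Mapping.lookup p w"
  by (auto simp: scale_def Poly_Mapping.map.rep_eq when_def)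

lemma keys_scale: "Poly_Mapping.keys (scale c p) \<subseteq> Poly_Mapping.keys p"
  by (auto simp: Poly_Mapping.in_keys_iff)

lemma scale_single [simp]: "scale c (Poly_Mapping.single w d) = Poly_Mapping.single w (c * d)"
  by (rule poly_mapping_eqI) (simp add: Poly_Mapping.lookup_single when_def)

lemma scale_zero [simp]: "scale c 0 = 0"
  by (rule poly_mapping_eqI) simp

lemma scale_add: "scale c (p + q) = scale c p + scale c q"
  by (rule poly_mapping_eqI) (simp add: Poly_Mapping.lookup_add algebra_simps)

lemma linear_extension_superset:
  assumes "finite F" "Poly_Mapping.keys p \<subseteq> F"
  shows "linear_extension g p = (\<Sum>w\<in>F. Poly_Mapping.single (g w) (Poly_Mapping.lookup p w))"
  unfolding linear_extension_def using assms
  by (intro sum.mono_neutral_left) (auto simp: Poly_Mapping.in_keys_iff)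

lemma linear_extension_single [simp]:
  "linear_extension g (Poly_Mapping.single w c) = Poly_Mapping.single (g w) c"
  by (subst linear_extension_superset[of "{w}"]) auto

lemma linear_extension_zero [simp]: "linear_extension g 0 = 0"
  by (simp add: linear_extension_def)

lemma linear_extension_add: "linear_extension g (p + q) = linear_extension g p + linear_extension g q"
proof -
  let ?F = "Poly_Mapping.keys p \<union> Poly_Mapping.keys q"
  show ?thesis
    using Poly_Mapping.keys_add[of p q]
    by (subst (1 2 3) linear_extension_superset[of ?F])
      (auto simp: Poly_Mapping.lookup_add Poly_Mapping.single_add sum.distrib)
qed

lemma linear_extension_scale: "linear_extension g (scale c p) = scale c (linear_extension g p)"
  by (induction p rule: poly_mapping_keys_induct[OF subset_UNIV])
    (simp_all add: linear_extension_add scale_add)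

lemma keys_linear_extension: "Poly_Mapping.keys (linear_extension g p) \<subseteq> g ` Poly_Mapping.keys p"
  unfolding linear_extension_def by (rule order_trans[OF Poly_Mapping.keys_sum]) auto

lemma scalar_ring_simps [simp]:
  "carrier scalar_ring = UNIV" "a \<otimes>\<^bsub>scalar_ring\<^esub> b = a * b" "\<one>\<^bsub>scalar_ring\<^esub> = 1"
  "\<zero>\<^bsub>scalar_ring\<^esub> = 0" "a \<oplus>\<^bsub>scalar_ring\<^esub> b = a + b"
  by (simp_all add: scalar_ring_def)

lemma cring_scalar_ring: "cring (scalar_ring :: 'k::{comm_ring, comm_monoid_mult} ring)"
proof (rule cringI)
  show "abelian_group (scalar_ring :: 'k ring)"
  proof (rule abelian_groupI)
    show "\<exists>y\<in>carrier scalar_ring. y \<oplus>\<^bsub>scalar_ring\<^esub> x = \<zero>\<^bsub>scalar_ring\<^esub>" for x :: 'k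
      by (rule bexI[of _ "- x"]) auto
  qed (auto simp: ac_simps)
  show "Group.comm_monoid (scalar_ring :: 'k ring)"
    by (rule comm_monoidI) (auto simp: ac_simps)
qed (auto simp: algebra_simps)

lemma free_op_algebra_simps [simp]:
  "carrier (free_op_algebra X) = {p. Poly_Mapping.keys p \<subseteq> \<Q> X}"
  "p \<otimes>\<^bsub>free_op_algebra X\<^esub> q = p * q" "\<zero>\<^bsub>free_op_algebra X\<^esub> = 0" "p \<oplus>\<^bsub>free_op_algebra X\<^esub> q = p + q"
  "c \<odot>\<^bsub>free_op_algebra X\<^esub> p = scale c p" "opP (free_op_algebra X) = extP" "opD (free_op_algebra X) = extD"
  by (simp_all add: free_op_algebra_def)

lemma scale_mult_left: "scale c p * q = scale c (p * q)"
  by (simp add: scale_def mult_map_scale_conv_mult mult.assoc)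

lemma scale_mult_right:
  fixes p q :: "'w::comm_monoid_add \<Rightarrow>\<^sub>0 'k::{comm_ring, comm_monoid_mult}"
  shows "p * scale c q = scale c (p * q)"
  using scale_mult_left[of c q p] by (simp add: mult.commute)

lemma comm_op_algebra_free:
  "comm_op_algebra scalar_ring (free_op_algebra X :: ('k::{comm_ring, comm_monoid_mult}, _) op_algebra)"
proof -
  let ?A = "free_op_algebra X :: ('k, _) op_algebra"
  have add: "Poly_Mapping.keys (p + q) \<subseteq> \<Q> X"
    if "Poly_Mapping.keys p \<subseteq> \<Q> X" "Poly_Mapping.keys q \<subseteq> \<Q> X" for p q :: "'a word \<Rightarrow>\<^sub>0 'k"
    using that Poly_Mapping.keys_add[of p q] by auto
  have mult: "Poly_Mapping.keys (p * q) \<subseteq> \<Q> X"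
    if "Poly_Mapping.keys p \<subseteq> \<Q> X" "Poly_Mapping.keys q \<subseteq> \<Q> X" for p q :: "'a word \<Rightarrow>\<^sub>0 'k"
    using that Poly_Mapping.keys_mult[of p q] Q_add by fastforce
  have "abelian_group ?A"
  proof (rule abelian_groupI)
    show "\<exists>q\<in>carrier ?A. q \<oplus>\<^bsub>?A\<^esub> p = \<zero>\<^bsub>?A\<^esub>" if "p \<in> carrier ?A" for p
      using that by (intro bexI[of _ "- p"]) (auto simp: Poly_Mapping.in_keys_iff)
  qed (auto simp: ac_simps dest: subsetD[OF add])
  then have "Module.module scalar_ring ?A"
  proof (intro moduleI cring_scalar_ring)
    show "c \<odot>\<^bsub>?A\<^esub> p \<in> carrier ?A" if "p \<in> carrier ?A" for c p
      using that keys_scale[of c p] by auto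
  qed (auto intro!: poly_mapping_eqI simp: Poly_Mapping.lookup_add algebra_simps)
  then show ?thesis
  proof (intro comm_op_algebra.intro comm_op_algebra_axioms.intro)
    show "opP ?A p \<in> carrier ?A" "opD ?A p \<in> carrier ?A" if "p \<in> carrier ?A" for p
      using that unfolding extP_def extD_def free_op_algebra_simps mem_Collect_eq
      by (blast intro: Q_LP Q_LD dest: subsetD[OF keys_linear_extension])+
  qed (use mult in \<open>auto simp: algebra_simps scale_mult_left scale_mult_right linear_extension_add linear_extension_scale extP_def extD_def\<close>)
qed

definition lincomb :: "('k::{comm_ring, comm_monoid_mult}, 'a) op_algebra \<Rightarrow> ('w \<Rightarrow> 'a) \<Rightarrow> ('w \<Rightarrow>\<^sub>0 'k) \<Rightarrow> 'a" where
  "lincomb A b p = (\<Oplus>\<^bsub>A\<^esub>w\<in>Poly_Mapping.keys p. Poly_Mapping.lookup p w \<odot>\<^bsub>A\<^esub> b w)"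

locale scalar_op_algebra = comm_op_algebra scalar_ring A
  for A :: "('k::{comm_ring, comm_monoid_mult}, 'a) op_algebra" (structure)
begin

lemma smult_zero: "x \<in> carrier A \<Longrightarrow> 0 \<odot> x = \<zero>"
  using smult_l_null[of x] by simp

lemma smult_add: "x \<in> carrier A \<Longrightarrow> (c + d) \<odot> x = c \<odot> x \<oplus> d \<odot> x"
  using smult_l_distr[of c d x] by simp

lemma smult_mult: "x \<in> carrier A \<Longrightarrow> (c * d) \<odot> x = c \<odot> (d \<odot> x)"
  using smult_assoc1[of c d x] by simp

lemma smult_1: "x \<in> carrier A \<Longrightarrow> 1 \<odot> x = x"
  using smult_one[of x] by simp

lemma mult_smult_right: "x \<in> carrier A \<Longrightarrow> y \<in> carrier A \<Longrightarrow> x \<otimes> (c \<odot> y) = c \<odot> (x \<otimes> y)"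
  using mult_smult_left[of c y x] by (simp add: mult_comm[of x])

lemma mult_add_right: "\<lbrakk>x \<in> carrier A; y \<in> carrier A; z \<in> carrier A\<rbrakk> \<Longrightarrow> x \<otimes> (y \<oplus> z) = x \<otimes> y \<oplus> x \<otimes> z"
  using mult_add_left[of y z x] by (simp add: mult_comm[of x])

context
  fixes W and b
  assumes b: "b \<in> W \<rightarrow> carrier A"
begin

lemma lincomb_superset:
  assumes "finite F" "Poly_Mapping.keys p \<subseteq> F" "F \<subseteq> W"
  shows "lincomb A b p = (\<Oplus>w\<in>F. Poly_Mapping.lookup p w \<odot> b w)"
  unfolding lincomb_def
  using assms b by (intro M.add.finprod_mono_neutral_cong_left) (auto simp: Poly_Mapping.in_keys_iff smult_zero Pi_def subset_iff)

lemma lincomb_closed: "Poly_Mapping.keys p \<subseteq> W \<Longrightarrow> lincomb A b p \<in> carrier A"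
  unfolding lincomb_def using b by (intro M.finsum_closed) (auto simp: Pi_def subset_iff)

lemma lincomb_single: "w \<in> W \<Longrightarrow> lincomb A b (Poly_Mapping.single w c) = c \<odot> b w"
  using b by (subst lincomb_superset[of "{w}"]) (auto simp: Pi_def)

lemma lincomb_zero: "lincomb A b 0 = \<zero>"
  by (simp add: lincomb_def)

lemma lincomb_add:
  assumes "Poly_Mapping.keys p \<subseteq> W" "Poly_Mapping.keys q \<subseteq> W"
  shows "lincomb A b (p + q) = lincomb A b p \<oplus> lincomb A b q"
proof -
  let ?F = "Poly_Mapping.keys p \<union> Poly_Mapping.keys q"
  have F: "finite ?F" "?F \<subseteq> W" "Poly_Mapping.keys p \<subseteq> ?F" "Poly_Mapping.keys q \<subseteq> ?F" "Poly_Mapping.keys (p + q) \<subseteq> ?F"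
    using Poly_Mapping.keys_add[of p q] assms by auto
  have b': "b w \<in> carrier A" if "w \<in> ?F" for w
    using b F that by auto
  have "lincomb A b (p + q) = (\<Oplus>w\<in>?F. Poly_Mapping.lookup p w \<odot> b w \<oplus> Poly_Mapping.lookup q w \<odot> b w)"
    unfolding lincomb_superset[OF F(1,5,2)] using b'
    by (intro M.finsum_cong') (auto simp: Poly_Mapping.lookup_add smult_add)
  also have "\<dots> = lincomb A b p \<oplus> lincomb A b q"
    unfolding lincomb_superset[OF F(1,3,2)] lincomb_superset[OF F(1,4,2)]
    using b' by (intro M.finsum_addf) auto
  finally show ?thesis .
qed

lemma lincomb_scale: "Poly_Mapping.keys p \<subseteq> W \<Longrightarrow> lincomb A b (scale c p) = c \<odot> lincomb A b p"
proof (induction p rule: poly_mapping_keys_induct)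
  case zero
  then show ?case using smult_r_null[of c] by (simp add: lincomb_zero)
next
  case (single w d)
  then show ?case using funcset_mem[OF b] by (simp add: lincomb_single smult_mult)
next
  case (add p q)
  then show ?case
    using keys_scale[of c p] keys_scale[of c q] smult_r_distr[of c "lincomb A b p" "lincomb A b q"]
    by (simp add: scale_add lincomb_add lincomb_closed subset_trans)
qed

end
end

section \<open>Morphisms, kernels and the universal property of \<open>K[X;\<Omega>]\<close>\<close>

lemma op_algebra_homI:
  assumes "\<And>u. u \<in> carrier A \<Longrightarrow> h u \<in> carrier B"
    and "\<And>u v. u \<in> carrier A \<Longrightarrow> v \<in> carrier A \<Longrightarrow> h (u \<oplus>\<^bsub>A\<^esub> v) = h u \<oplus>\<^bsub>B\<^esub> h v"
    and "\<And>u v. u \<in> carrier A \<Longrightarrow> v \<in> carrier A \<Longrightarrow> h (u \<otimes>\<^bsub>A\<^esub> v) = h u \<otimes>\<^bsub>B\<^esub> h v"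
    and "\<And>c u. c \<in> carrier K \<Longrightarrow> u \<in> carrier A \<Longrightarrow> h (c \<odot>\<^bsub>A\<^esub> u) = c \<odot>\<^bsub>B\<^esub> h u"
    and "\<And>u. u \<in> carrier A \<Longrightarrow> h (opP A u) = opP B (h u)"
    and "\<And>u. u \<in> carrier A \<Longrightarrow> h (opD A u) = opD B (h u)"
  shows "h \<in> op_algebra_hom K A B"
  using assms by (auto simp: op_algebra_hom_def hom_def)

lemma op_algebra_homD:
  assumes "h \<in> op_algebra_hom K A B"
  shows "u \<in> carrier A \<Longrightarrow> h u \<in> carrier B"
    and "u \<in> carrier A \<Longrightarrow> v \<in> carrier A \<Longrightarrow> h (u \<oplus>\<^bsub>A\<^esub> v) = h u \<oplus>\<^bsub>B\<^esub> h v"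
    and "u \<in> carrier A \<Longrightarrow> v \<in> carrier A \<Longrightarrow> h (u \<otimes>\<^bsub>A\<^esub> v) = h u \<otimes>\<^bsub>B\<^esub> h v"
    and "c \<in> carrier K \<Longrightarrow> u \<in> carrier A \<Longrightarrow> h (c \<odot>\<^bsub>A\<^esub> u) = c \<odot>\<^bsub>B\<^esub> h u"
    and "u \<in> carrier A \<Longrightarrow> h (opP A u) = opP B (h u)"
    and "u \<in> carrier A \<Longrightarrow> h (opD A u) = opD B (h u)"
  using assms by (auto simp: op_algebra_hom_def hom_def)

lemma op_algebra_hom_zero:
  assumes "comm_op_algebra K A" "comm_op_algebra K B" and h: "h \<in> op_algebra_hom K A B"
  shows "h \<zero>\<^bsub>A\<^esub> = \<zero>\<^bsub>B\<^esub>"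
proof -
  interpret A: comm_op_algebra K A by fact
  interpret B: comm_op_algebra K B by fact
  have "h (\<zero>\<^bsub>A\<^esub> \<oplus>\<^bsub>A\<^esub> \<zero>\<^bsub>A\<^esub>) = h \<zero>\<^bsub>A\<^esub> \<oplus>\<^bsub>B\<^esub> h \<zero>\<^bsub>A\<^esub>"
    by (rule op_algebra_homD[OF h]) auto
  then show ?thesis
    using op_algebra_homD(1)[OF h A.M.zero_closed] by simp
qed

lemma (in comm_op_algebra) mult_zero_left: "x \<in> carrier A \<Longrightarrow> \<zero> \<otimes> x = \<zero>"
  using mult_smult_left[of "\<zero>\<^bsub>K\<^esub>" \<zero> x] mult_closed[of \<zero> x] by simp

lemma (in comm_op_algebra) opP_zero: "opP A \<zero> = \<zero>"
  using opP_smult[of "\<zero>\<^bsub>K\<^esub>" \<zero>] opP_closed[of \<zero>] by simp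

lemma (in comm_op_algebra) opD_zero: "opD A \<zero> = \<zero>"
  using opD_smult[of "\<zero>\<^bsub>K\<^esub>" \<zero>] opD_closed[of \<zero>] by simp

text \<open>A generated ideal is known only as an intersection. A map is shown to vanish on it by
  placing the generators in the kernel, which takes part in that intersection.\<close>

lemma op_ideal_kernel:
  assumes "comm_op_algebra K A" "comm_op_algebra K B" and h: "h \<in> op_algebra_hom K A B"
  shows "op_ideal K A {u \<in> carrier A. h u = \<zero>\<^bsub>B\<^esub>}"
proof -
  interpret A: comm_op_algebra K A by fact
  interpret B: comm_op_algebra K B by fact
  note hD = op_algebra_homD[OF h]
  have "submodule {u \<in> carrier A. h u = \<zero>\<^bsub>B\<^esub>} K A"
  proof (rule A.submoduleI)
    show "\<ominus>\<^bsub>A\<^esub> u \<in> {u \<in> carrier A. h u = \<zero>\<^bsub>B\<^esub>}" if "u \<in> {u \<in> carrier A. h u = \<zero>\<^bsub>B\<^esub>}" for u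
    proof -
      from that have "h (u \<oplus>\<^bsub>A\<^esub> \<ominus>\<^bsub>A\<^esub> u) = h (\<ominus>\<^bsub>A\<^esub> u)"
        using hD(1)[of "\<ominus>\<^bsub>A\<^esub> u"] by (subst hD) auto
      then show ?thesis
        using that op_algebra_hom_zero[OF assms] by (simp add: A.M.r_neg)
    qed
  qed (auto simp: hD op_algebra_hom_zero[OF assms])
  then show ?thesis
    unfolding op_ideal_def
    by (auto simp: hD A.mult_closed A.opP_closed A.opD_closed B.mult_zero_left B.opP_zero B.opD_zero
         B.mult_comm[of _ "\<zero>\<^bsub>B\<^esub>"])
qed

context scalar_op_algebra begin

context
  fixes X :: "'x set" and f
  assumes f: "f \<in> X \<rightarrow> carrier A"
begin

lemma eval_word_Pi: "eval_word A f \<in> \<Q> X \<rightarrow> carrier A"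
  using eval_word_closed[OF f] by blast

lemmas lincomb_word = lincomb_closed[OF eval_word_Pi] lincomb_single[OF eval_word_Pi] lincomb_zero[OF eval_word_Pi]
  lincomb_add[OF eval_word_Pi] lincomb_scale[OF eval_word_Pi]

text \<open>Existence half of the freeness of \<open>K[X;\<Omega>]\<close> among commutative
  algebras with two linear operators. Each law is linear in every argument and so reduces to single
  words, where evaluation satisfies it.\<close>

lemma lincomb_eval_word_hom: "lincomb A (eval_word A f) \<in> op_algebra_hom scalar_ring (free_op_algebra X) A"
proof -
  interpret F: scalar_op_algebra "free_op_algebra X :: ('k, _) op_algebra"
    by (rule scalar_op_algebra.intro comm_op_algebra_free)+
  note mc = F.mult_closed[simplified] and Pc = F.opP_closed[simplified] and Dc = F.opD_closed[simplified]
  note W = eval_word_closed[OF f]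
  let ?E = "lincomb A (eval_word A f)"
  have mult: "?E (p * q) = ?E p \<otimes> ?E q"
    if p: "Poly_Mapping.keys p \<subseteq> \<Q> X" and q: "Poly_Mapping.keys q \<subseteq> \<Q> X" for p q
    using p
  proof (induction p rule: poly_mapping_keys_induct)
    case zero
    then show ?case using q by (simp add: lincomb_word mult_zero_left)
  next
    case (add p p')
    then show ?case using q by (simp add: distrib_right lincomb_word mc mult_add_left)
  next
    case (single u c)
    have s: "Poly_Mapping.keys (Poly_Mapping.single u c) \<subseteq> \<Q> X" using single by simp
    show ?case using q
    proof (induction q rule: poly_mapping_keys_induct)
      case zero
      then show ?case using single W by (simp add: lincomb_word mult_comm[of _ \<zero>] mult_zero_left)
    next
      case (add p p')
      then show ?case using s by (simp add: distrib_left lincomb_word mc mult_add_right)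
    next
      case (single v d)
      then show ?case using \<open>u \<in> \<Q> X\<close> W
        by (simp add: Q_add mult.commute[of c d] Poly_Mapping.mult_single lincomb_word eval_word_add[OF f] mult_closed mult_smult_left mult_smult_right smult_mult)
    qed
  qed
  have P: "?E (extP p) = opP A (?E p)" if "Poly_Mapping.keys p \<subseteq> \<Q> X" for p
    using that
  proof (induction p rule: poly_mapping_keys_induct)
    case (add p q)
    then show ?case using Pc[of p] Pc[of q] by (simp add: extP_def linear_extension_add lincomb_word opP_add)
  qed (simp_all add: extP_def lincomb_word opP_zero Q_LP W opP_smult eval_word_LP[OF f])
  have D: "?E (extD p) = opD A (?E p)" if "Poly_Mapping.keys p \<subseteq> \<Q> X" for p
    using that
  proof (induction p rule: poly_mapping_keys_induct)
    case (add p q)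
    then show ?case using Dc[of p] Dc[of q] by (simp add: extD_def linear_extension_add lincomb_word opD_add)
  qed (simp_all add: extD_def lincomb_word opD_zero Q_LD W opD_smult eval_word_LD[OF f])
  show ?thesis
    by (rule op_algebra_homI) (simp_all add: lincomb_word mult P D)
qed

lemma lincomb_eval_word_mon: "w \<in> \<Q> X \<Longrightarrow> lincomb A (eval_word A f) (word_mon w) = eval_word A f w"
  using eval_word_closed[OF f] by (simp add: word_mon_def lincomb_word smult_1)

text \<open>Uniqueness half: a morphism is forced on words by \<open>Q_induct\<close> and on
  combinations by linearity. It serves both to recognise the quotient map as an evaluation and to
  compare two morphisms out of the quotient.\<close>

lemma op_algebra_hom_free_unique:
  assumes h: "h \<in> op_algebra_hom scalar_ring (free_op_algebra X) A"
    and hf: "\<And>x. x \<in> X \<Longrightarrow> h (word_mon {#Gen x#}) = f x"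
  shows "Poly_Mapping.keys p \<subseteq> \<Q> X \<Longrightarrow> h p = lincomb A (eval_word A f) p"
proof -
  note hD = op_algebra_homD[OF h, simplified]
  have words: "h (word_mon w) = eval_word A f w" if "w \<in> \<Q> X" for w
    using that
  proof (induction rule: Q_induct)
    case (Gen x)
    then show ?case by (simp add: hf eval_word_Gen[OF f])
  next
    case (LP u)
    then show ?case using hD(5)[of "word_mon u"]
      by (simp add: eval_word_LP[OF f]) (simp add: word_mon_def extP_def)
  next
    case (LD u)
    then show ?case using hD(6)[of "word_mon u"]
      by (simp add: eval_word_LD[OF f]) (simp add: word_mon_def extD_def)
  next
    case (add u v)
    then show ?case using hD(3)[of "word_mon u" "word_mon v"]
      by (simp add: eval_word_add[OF f]) (simp add: word_mon_def Poly_Mapping.mult_single)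
  qed
  assume "Poly_Mapping.keys p \<subseteq> \<Q> X"
  then show ?thesis
  proof (induction p rule: poly_mapping_keys_induct)
    case zero
    have "h \<zero>\<^bsub>free_op_algebra X\<^esub> = \<zero>"
      by (rule op_algebra_hom_zero[OF comm_op_algebra_free comm_op_algebra_axioms h])
    then show ?case by (simp add: lincomb_word)
  next
    case (single w c)
    then show ?case
      using hD(4)[of "word_mon w" c] words[of w] by (simp add: lincomb_word) (simp add: word_mon_def)
  next
    case (add p q)
    then show ?case by (simp add: hD(2) lincomb_word)
  qed
qed

end
end

section \<open>The defining relations and their vanishing under evaluation\<close>

lemma op_ideal_generated_subset: "op_ideal K A I \<Longrightarrow> S \<subseteq> I \<Longrightarrow> op_ideal_generated K A S \<subseteq> I"
  by (auto simp: op_ideal_generated_def)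

lemma keys_Q_closed:
  fixes p q :: "'x word \<Rightarrow>\<^sub>0 'k::{comm_ring, comm_monoid_mult}"
  shows "w \<in> \<Q> X \<Longrightarrow> Poly_Mapping.keys (word_mon w :: 'x word \<Rightarrow>\<^sub>0 'k) \<subseteq> \<Q> X"
    and "Poly_Mapping.keys p \<subseteq> \<Q> X \<Longrightarrow> Poly_Mapping.keys q \<subseteq> \<Q> X \<Longrightarrow> Poly_Mapping.keys (p + q) \<subseteq> \<Q> X"
    and "Poly_Mapping.keys p \<subseteq> \<Q> X \<Longrightarrow> Poly_Mapping.keys q \<subseteq> \<Q> X \<Longrightarrow> Poly_Mapping.keys (p - q) \<subseteq> \<Q> X"
    and "Poly_Mapping.keys p \<subseteq> \<Q> X \<Longrightarrow> Poly_Mapping.keys q \<subseteq> \<Q> X \<Longrightarrow> Poly_Mapping.keys (p * q) \<subseteq> \<Q> X"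
    and "Poly_Mapping.keys p \<subseteq> \<Q> X \<Longrightarrow> Poly_Mapping.keys (scale c p) \<subseteq> \<Q> X"
    and "Poly_Mapping.keys p \<subseteq> \<Q> X \<Longrightarrow> Poly_Mapping.keys (extP p) \<subseteq> \<Q> X"
    and "Poly_Mapping.keys p \<subseteq> \<Q> X \<Longrightarrow> Poly_Mapping.keys (extD p) \<subseteq> \<Q> X"
proof -
  show "w \<in> \<Q> X \<Longrightarrow> Poly_Mapping.keys (word_mon w :: 'x word \<Rightarrow>\<^sub>0 'k) \<subseteq> \<Q> X"
    by (simp add: word_mon_def)
  show "Poly_Mapping.keys p \<subseteq> \<Q> X \<Longrightarrow> Poly_Mapping.keys q \<subseteq> \<Q> X \<Longrightarrow> Poly_Mapping.keys (p + q) \<subseteq> \<Q> X"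
    "Poly_Mapping.keys p \<subseteq> \<Q> X \<Longrightarrow> Poly_Mapping.keys q \<subseteq> \<Q> X \<Longrightarrow> Poly_Mapping.keys (p - q) \<subseteq> \<Q> X"
    using Poly_Mapping.keys_add[of p q] Poly_Mapping.keys_diff[of p q] by blast+
  show "Poly_Mapping.keys p \<subseteq> \<Q> X \<Longrightarrow> Poly_Mapping.keys (scale c p) \<subseteq> \<Q> X"
    using keys_scale[of c p] by blast
qed (use comm_op_algebra.mult_closed[OF comm_op_algebra_free, of p X q]
    comm_op_algebra.opP_closed[OF comm_op_algebra_free, of p X]
    comm_op_algebra.opD_closed[OF comm_op_algebra_free, of p X] in simp_all)

text \<open>The subtracted terms are collected, so that each relation is a difference of the two
  sides of an identity and its vanishing becomes an equation.\<close>

lemma drb_relations_cases [consumes 1, case_names rota_baxter leibniz opD_opP]: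
  assumes "r \<in> drb_relations lam X"
  obtains u v where "u \<in> \<Q> X" "v \<in> \<Q> X" "r = extP (word_mon u) * extP (word_mon v)
        - (extP (word_mon u * extP (word_mon v)) + extP (extP (word_mon u) * word_mon v)
          + scale lam (extP (word_mon u * word_mon v)))"
  | u v where "u \<in> \<Q> X" "v \<in> \<Q> X" "r = extD (word_mon u * word_mon v)
        - (extD (word_mon u) * word_mon v + word_mon u * extD (word_mon v)
          + scale lam (extD (word_mon u) * extD (word_mon v)))"
  | u where "u \<in> \<Q> X" "r = extD (extP (word_mon u)) - word_mon u"
  using assms unfolding drb_relations_def diff_diff_eq by blast

lemma drb_relations_carrier: "drb_relations lam X \<subseteq> carrier (free_op_algebra X)"
proof
  fix r assume "r \<in> drb_relations lam X"
  then show "r \<in> carrier (free_op_algebra X)"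
    by (cases rule: drb_relations_cases) (simp_all add: keys_Q_closed)
qed

lemma drb_relationsI:
  assumes "u \<in> \<Q> X"
  shows "v \<in> \<Q> X \<Longrightarrow> extP (word_mon u) * extP (word_mon v)
        - (extP (word_mon u * extP (word_mon v)) + extP (extP (word_mon u) * word_mon v)
          + scale lam (extP (word_mon u * word_mon v))) \<in> drb_relations lam X"
   and "v \<in> \<Q> X \<Longrightarrow> extD (word_mon u * word_mon v)
        - (extD (word_mon u) * word_mon v + word_mon u * extD (word_mon v)
          + scale lam (extD (word_mon u) * extD (word_mon v))) \<in> drb_relations lam X"
   and "extD (extP (word_mon u)) - word_mon u \<in> drb_relations lam X"
  using assms unfolding drb_relations_def diff_diff_eq by blast+

text \<open>The relations express identities of \<open>A\<close> at the values of words, so they lie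
  in the kernel of evaluation. This makes induced morphisms on the quotient well defined and,
  applied to the model, transfers independence back to the quotient.\<close>

lemma lincomb_eval_word_drb_ideal:
  fixes lam :: "'k::{comm_ring, comm_monoid_mult}"
  assumes "diff_rota_baxter_algebra scalar_ring lam A" and f: "f \<in> X \<rightarrow> carrier A"
    and p: "p \<in> drb_ideal lam X"
  shows "lincomb A (eval_word A f) p = \<zero>\<^bsub>A\<^esub>"
proof -
  interpret A: diff_rota_baxter_algebra scalar_ring lam A by fact
  interpret A: scalar_op_algebra A by unfold_locales
  let ?E = "lincomb A (eval_word A f)"
  note hom = A.lincomb_eval_word_hom[OF f]
  note hD = op_algebra_homD[OF hom, simplified]
  have diff: "?E (p - q) = \<zero>\<^bsub>A\<^esub> \<longleftrightarrow> ?E p = ?E q"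
    if "Poly_Mapping.keys p \<subseteq> \<Q> X" "Poly_Mapping.keys q \<subseteq> \<Q> X" for p q
  proof -
    have "?E p = ?E (p - q) \<oplus>\<^bsub>A\<^esub> ?E q"
      using hD(2)[of "p - q" q] that by (simp add: keys_Q_closed)
    moreover have "?E (p - q) \<in> carrier A" "?E q \<in> carrier A"
      using hD(1) that by (simp_all add: keys_Q_closed)
    ultimately show ?thesis
      using A.M.add.right_cancel[of "?E q" "?E (p - q)" "\<zero>\<^bsub>A\<^esub>"] by auto
  qed
  have "drb_relations lam X \<subseteq> {u \<in> carrier (free_op_algebra X). ?E u = \<zero>\<^bsub>A\<^esub>}"
  proof
    fix r assume "r \<in> drb_relations lam X"
    then show "r \<in> {u \<in> carrier (free_op_algebra X). ?E u = \<zero>\<^bsub>A\<^esub>}"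
      by (cases rule: drb_relations_cases)
        (simp_all add: diff hD keys_Q_closed A.rota_baxter A.leibniz A.opD_opP)
  qed
  then have "drb_ideal lam X \<subseteq> {u \<in> carrier (free_op_algebra X). ?E u = \<zero>\<^bsub>A\<^esub>}"
    unfolding drb_ideal_def
    by (intro op_ideal_generated_subset op_ideal_kernel[OF comm_op_algebra_free A.comm_op_algebra_axioms hom])
  then show ?thesis using p by blast
qed

section \<open>Quotients by operated ideals\<close>

context comm_op_algebra begin

context
  fixes I assumes I: "op_ideal K A I"
begin

lemma op_ideal_D:
  shows "I \<subseteq> carrier A" "\<zero> \<in> I" "i \<in> I \<Longrightarrow> j \<in> I \<Longrightarrow> i \<oplus> j \<in> I"
    "c \<in> carrier K \<Longrightarrow> i \<in> I \<Longrightarrow> c \<odot> i \<in> I" "a \<in> carrier A \<Longrightarrow> i \<in> I \<Longrightarrow> a \<otimes> i \<in> I"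
    "a \<in> carrier A \<Longrightarrow> i \<in> I \<Longrightarrow> i \<otimes> a \<in> I" "i \<in> I \<Longrightarrow> opP A i \<in> I" "i \<in> I \<Longrightarrow> opD A i \<in> I"
proof -
  interpret submodule I K A using I by (simp add: op_ideal_def)
  show "I \<subseteq> carrier A" "\<zero> \<in> I" "i \<in> I \<Longrightarrow> j \<in> I \<Longrightarrow> i \<oplus> j \<in> I"
    "c \<in> carrier K \<Longrightarrow> i \<in> I \<Longrightarrow> c \<odot> i \<in> I"
    using subset one_closed m_closed[of i j] smult_closed[of c i] by auto
  show "a \<in> carrier A \<Longrightarrow> i \<in> I \<Longrightarrow> a \<otimes> i \<in> I"
    "a \<in> carrier A \<Longrightarrow> i \<in> I \<Longrightarrow> i \<otimes> a \<in> I" "i \<in> I \<Longrightarrow> opP A i \<in> I" "i \<in> I \<Longrightarrow> opD A i \<in> I"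
    using I by (auto simp: op_ideal_def)
qed

lemma op_ideal_abelian_subgroup: "abelian_subgroup I A"
proof (rule abelian_subgroupI3)
  show "additive_subgroup I A"
    using I by (simp add: op_ideal_def submodule_def additive_subgroup_def)
qed (rule M.abelian_group_axioms)

lemma coset_absorb: "i \<in> I \<Longrightarrow> a \<in> carrier A \<Longrightarrow> I +> (i \<oplus> a) = I +> a"
proof -
  interpret abelian_subgroup I A by (rule op_ideal_abelian_subgroup)
  assume "i \<in> I" "a \<in> carrier A"
  moreover from this have "i \<oplus> a \<in> I +> a" by (auto simp: a_r_coset_def')
  ultimately show ?thesis by (metis a_repr_independence')
qed

lemma coset_eq_zero_iff: "a \<in> carrier A \<Longrightarrow> I +> a = I \<longleftrightarrow> a \<in> I"
proof -
  interpret abelian_subgroup I A by (rule op_ideal_abelian_subgroup)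
  assume "a \<in> carrier A"
  then show ?thesis
    using a_rcos_self[of a] a_rcos_const[of a] by auto
qed

text \<open>An operation applied to all representatives yields a union of equal cosets as soon as
  changing the representative by \<open>I\<close> changes the value by \<open>I\<close>. This treats
  scalars, both operators, and multiplication in one argument at a time.\<close>

lemma coset_Union:
  assumes "a \<in> carrier A" "\<And>i. i \<in> I \<Longrightarrow> \<exists>j\<in>I. g (i \<oplus> a) = j \<oplus> g a" "g a \<in> carrier A"
  shows "(\<Union>b\<in>I +> a. I +> g b) = I +> g a"
proof -
  have "I +> g b = I +> g a" if b: "b \<in> I +> a" for b
  proof -
    obtain i where "i \<in> I" "b = i \<oplus> a" using b by (auto simp: a_r_coset_def')
    then show ?thesis using assms coset_absorb by metis
  qed
  moreover have "a \<in> I +> a"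
    using abelian_subgroup.a_rcos_self[OF op_ideal_abelian_subgroup] assms(1) by blast
  ultimately show ?thesis by blast
qed

lemma op_quotient_smult: "c \<in> carrier K \<Longrightarrow> a \<in> carrier A \<Longrightarrow> c \<odot>\<^bsub>op_quotient A I\<^esub> (I +> a) = I +> (c \<odot> a)"
  unfolding op_quotient_def using op_ideal_D(1)
  by (simp, intro coset_Union) (auto simp: smult_r_distr op_ideal_D(4) subset_iff)

lemma op_quotient_opP: "a \<in> carrier A \<Longrightarrow> opP (op_quotient A I) (I +> a) = I +> opP A a"
  unfolding op_quotient_def using op_ideal_D(1)
  by (simp, intro coset_Union) (auto simp: opP_add opP_closed op_ideal_D(7) subset_iff)

lemma op_quotient_opD: "a \<in> carrier A \<Longrightarrow> opD (op_quotient A I) (I +> a) = I +> opD A a"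
  unfolding op_quotient_def using op_ideal_D(1)
  by (simp, intro coset_Union) (auto simp: opD_add opD_closed op_ideal_D(8) subset_iff)

lemma op_quotient_add: "a \<in> carrier A \<Longrightarrow> b \<in> carrier A \<Longrightarrow> (I +> a) \<oplus>\<^bsub>op_quotient A I\<^esub> (I +> b) = I +> (a \<oplus> b)"
  using abelian_subgroup.a_rcos_sum[OF op_ideal_abelian_subgroup] by (simp add: op_quotient_def)

lemma op_quotient_mult:
  assumes a: "a \<in> carrier A" and b: "b \<in> carrier A"
  shows "(I +> a) \<otimes>\<^bsub>op_quotient A I\<^esub> (I +> b) = I +> (a \<otimes> b)"
proof -
  \<comment> \<open>The product of two cosets is a double union; its inner union is collapsed first,
    with \<open>x\<close> fixed.\<close>
  have *: "(\<Union>y\<in>I +> b. I +> x \<otimes> y) = I +> (x \<otimes> b)" if "x \<in> carrier A" for x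
    using that b op_ideal_D(1)
    by (intro coset_Union) (auto simp: mult_closed mult_comm[of x] mult_add_left op_ideal_D(6) subset_iff)
  have "I +> a \<subseteq> carrier A"
    using a op_ideal_D(1) by (auto simp: a_r_coset_def')
  then have "(\<Union>x\<in>I +> a. \<Union>y\<in>I +> b. I +> x \<otimes> y) = (\<Union>x\<in>I +> a. I +> (x \<otimes> b))"
    using * by (intro SUP_cong refl) blast
  also have "\<dots> = I +> (a \<otimes> b)"
    using a b op_ideal_D(1)
    by (intro coset_Union) (auto simp: mult_closed mult_add_left op_ideal_D(6) subset_iff)
  finally show ?thesis by (simp add: op_quotient_def rcoset_mult_def)
qed

lemma carrier_op_quotient: "carrier (op_quotient A I) = (\<lambda>a. I +> a) ` carrier A"
  by (auto simp: op_quotient_def A_RCOSETS_def')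

lemma zero_op_quotient: "\<zero>\<^bsub>op_quotient A I\<^esub> = I +> \<zero>"
  using coset_eq_zero_iff[of \<zero>] op_ideal_D(2) by (simp add: op_quotient_def)

lemmas op_quotient_ops = op_quotient_smult op_quotient_opP op_quotient_opD op_quotient_add
  op_quotient_mult zero_op_quotient

lemma comm_op_algebra_quotient: "comm_op_algebra K (op_quotient A I)"
proof -
  let ?B = "op_quotient A I"
  have ab: "abelian_group ?B"
  proof (rule abelian_groupI)
    show "\<exists>y\<in>carrier ?B. y \<oplus>\<^bsub>?B\<^esub> x = \<zero>\<^bsub>?B\<^esub>" if x: "x \<in> carrier ?B" for x
    proof -
      obtain a where "a \<in> carrier A" "x = I +> a" using x by (auto simp: carrier_op_quotient)
      then show ?thesis
        by (intro bexI[of _ "I +> (\<ominus> a)"]) (auto simp: op_quotient_ops carrier_op_quotient M.l_neg)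
    qed
  qed (auto simp: carrier_op_quotient op_quotient_ops M.a_ac)
  have mod: "Module.module K ?B"
    by (intro moduleI ab R.cring_axioms)
      (auto simp: carrier_op_quotient op_quotient_ops smult_l_distr smult_r_distr smult_assoc1)
  show ?thesis
  proof (intro comm_op_algebra.intro comm_op_algebra_axioms.intro mod)
    show "x \<otimes>\<^bsub>?B\<^esub> y = y \<otimes>\<^bsub>?B\<^esub> x" if "x \<in> carrier ?B" "y \<in> carrier ?B" for x y
    proof -
      obtain a b where "a \<in> carrier A" "x = I +> a" "b \<in> carrier A" "y = I +> b"
        using \<open>x \<in> carrier ?B\<close> \<open>y \<in> carrier ?B\<close> by (auto simp: carrier_op_quotient)
      then show ?thesis by (simp add: op_quotient_ops mult_comm[of a b])
    qed
  qed (auto simp: carrier_op_quotient op_quotient_ops mult_closed mult_assoc mult_add_left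
        mult_smult_left opP_closed opP_add opP_smult opD_closed opD_add opD_smult)
qed

lemma op_quotient_hom: "(\<lambda>a. I +> a) \<in> op_algebra_hom K A (op_quotient A I)"
  by (rule op_algebra_homI) (auto simp: carrier_op_quotient op_quotient_ops)

end

text \<open>Keeps the family intersected in \<open>op_ideal_generated\<close> nonempty, so that the
  intersection lies in the carrier.\<close>

lemma op_ideal_carrier: "op_ideal K A (carrier A)"
proof -
  have "submodule (carrier A) K A" by (rule submoduleI) auto
  then show ?thesis by (simp add: op_ideal_def mult_closed opP_closed opD_closed)
qed

lemma op_ideal_op_ideal_generated:
  assumes "S \<subseteq> carrier A"
  shows "op_ideal K A (op_ideal_generated K A S)"
proof -
  note D = op_ideal_D
  have "submodule (op_ideal_generated K A S) K A"
  proof (rule submoduleI)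
    show "op_ideal_generated K A S \<subseteq> carrier A"
      using assms op_ideal_carrier by (auto simp: op_ideal_generated_def)
    have neg: "\<ominus> i \<in> I" if "op_ideal K A I" "i \<in> I" for I i
      using abelian_subgroup.axioms(1)[OF op_ideal_abelian_subgroup[OF that(1)]] that(2)
      by (rule additive_subgroup.a_inv_closed)
    show "\<And>a. a \<in> op_ideal_generated K A S \<Longrightarrow> \<ominus> a \<in> op_ideal_generated K A S"
      by (auto simp: op_ideal_generated_def neg)
  qed (auto simp: op_ideal_generated_def D)
  then show ?thesis
    by (auto simp: op_ideal_def[of _ _ "op_ideal_generated K A S"])
      (auto simp: op_ideal_generated_def D)
qed

end

section \<open>Reduction to \<open>\<Upsilon>(D\<^sup>\<omega>(X))\<close>\<close>

lemma D_power_Suc: "D_power (Suc i) x = LD {#D_power i x#}"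
  by (simp add: D_power_def)

lemma CS_add: "u \<in> CS Y \<Longrightarrow> v \<in> CS Y \<Longrightarrow> u + v \<in> CS Y"
  by (auto simp: CS_def)

lemma D_power_Q: "x \<in> X \<Longrightarrow> {#D_power i x#} \<in> \<Q> X"
  by (induction i) (simp_all add: D_power_Suc Q_LD, simp add: D_power_def Q_Gen)

lemma CS_D_omega_Q: "u \<in> CS (D_omega X) \<Longrightarrow> u \<in> \<Q> X"
proof (induction rule: CS_induct)
  case (single y)
  then show ?case by (auto simp: D_omega_def D_power_Q)
next
  case (add y v)
  then have "{#y#} \<in> \<Q> X" by (auto simp: D_omega_def D_power_Q)
  then show ?case using add by (intro Q_add)
qed

lemma Upsilon_level_cases [consumes 1, case_names base P mult]:
  assumes "w \<in> \<Upsilon>_level X n"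
  obtains "w \<in> CS (D_omega X)"
  | m v where "n = Suc m" "v \<in> \<Upsilon>_level X m" "w = {#LP v#}"
  | m u v where "n = Suc m" "u \<in> CS (D_omega X)" "v \<in> \<Upsilon>_level X m" "w = u + {#LP v#}"
  using assms by (cases n) auto

lemma Upsilon_cases [consumes 1, case_names base P mult]:
  assumes "w \<in> \<Upsilon> X"
  obtains "w \<in> CS (D_omega X)"
  | v where "v \<in> \<Upsilon> X" "w = {#LP v#}"
  | u v where "u \<in> CS (D_omega X)" "v \<in> \<Upsilon> X" "w = u + {#LP v#}"
proof -
  obtain n where "w \<in> \<Upsilon>_level X n" using assms by (auto simp: \<Upsilon>_def)
  then show ?thesis
    by (cases rule: Upsilon_level_cases) (use that in \<open>auto simp: \<Upsilon>_def\<close>)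
qed

lemma Upsilon_base: "u \<in> CS (D_omega X) \<Longrightarrow> u \<in> \<Upsilon> X"
  by (auto simp: \<Upsilon>_def intro: exI[of _ 0])

lemma Upsilon_LP:
  assumes "v \<in> \<Upsilon> X" shows "{#LP v#} \<in> \<Upsilon> X"
proof -
  obtain n where "v \<in> \<Upsilon>_level X n" using assms by (auto simp: \<Upsilon>_def)
  then have "{#LP v#} \<in> \<Upsilon>_level X (Suc n)" by auto
  then show ?thesis unfolding \<Upsilon>_def by blast
qed

lemma Upsilon_base_mult:
  assumes "u \<in> CS (D_omega X)" "w \<in> \<Upsilon> X" shows "u + w \<in> \<Upsilon> X"
proof -
  have *: "u + {#LP v#} \<in> \<Upsilon> X" if "u \<in> CS (D_omega X)" "v \<in> \<Upsilon> X" for u v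
  proof -
    obtain n where "v \<in> \<Upsilon>_level X n" using \<open>v \<in> \<Upsilon> X\<close> by (auto simp: \<Upsilon>_def)
    then have "u + {#LP v#} \<in> \<Upsilon>_level X (Suc n)" using \<open>u \<in> CS (D_omega X)\<close> by auto
    then show ?thesis unfolding \<Upsilon>_def by blast
  qed
  from assms(2) show ?thesis
  proof (cases rule: Upsilon_cases)
    case base
    then show ?thesis using assms(1) by (simp add: CS_add Upsilon_base)
  next
    case (P v)
    then show ?thesis using * assms(1) by simp
  next
    case (mult u' v)
    then show ?thesis using *[OF CS_add[OF assms(1) mult(1)] mult(2)] by (simp only: add.assoc)
  qed
qed

lemma Upsilon_Q: "\<Upsilon> X \<subseteq> \<Q> X"
proof -
  have "w \<in> \<Q> X" if "w \<in> \<Upsilon>_level X n" for n w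
    using that
  proof (induction n arbitrary: w)
    case (Suc n)
    from Suc.prems show ?case
      by (cases rule: Upsilon_level_cases)
        (use Suc.IH in \<open>simp_all add: CS_D_omega_Q Q_LP Q_add del: union_mset_add_mset_right\<close>)
  qed (simp add: CS_D_omega_Q)
  then show ?thesis by (auto simp: \<Upsilon>_def)
qed

text \<open>Reduction takes place among values in an arbitrary differential Rota-Baxter algebra. The
  identities are then equations between elements, and no cosets or choices of representatives
  enter.\<close>

locale evaluated_drb = diff_rota_baxter_algebra scalar_ring lam A
  for lam :: "'k::{comm_ring, comm_monoid_mult}" and A :: "('k, 'a) op_algebra" (structure) +
  fixes X :: "'x set" and f
  assumes f: "f \<in> X \<rightarrow> carrier A"
begin

sublocale scalar_op_algebra A by unfold_locales

abbreviation "e \<equiv> eval_word A f"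

definition Upsilon_span where
  "Upsilon_span = lincomb A e ` {p. Poly_Mapping.keys p \<subseteq> \<Upsilon> X}"

lemma e_closed: "w \<in> \<Q> X \<Longrightarrow> e w \<in> carrier A"
  by (rule eval_word_closed[OF f])

lemma e_Pi: "e \<in> \<Upsilon> X \<rightarrow> carrier A"
  using Upsilon_Q e_closed by blast

lemma e_Upsilon: "w \<in> \<Upsilon> X \<Longrightarrow> e w \<in> carrier A"
  using e_Pi by blast

lemma Upsilon_span_closed: "x \<in> Upsilon_span \<Longrightarrow> x \<in> carrier A"
  by (auto simp: Upsilon_span_def lincomb_closed[OF e_Pi])

lemma Upsilon_span_word: "w \<in> \<Upsilon> X \<Longrightarrow> e w \<in> Upsilon_span"
  unfolding Upsilon_span_def
  by (rule image_eqI[of _ _ "Poly_Mapping.single w 1"])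
    (simp_all add: lincomb_single[OF e_Pi] smult_1 e_Upsilon)

lemma Upsilon_span_zero: "\<zero> \<in> Upsilon_span"
  unfolding Upsilon_span_def by (rule image_eqI[of _ _ 0]) (simp_all add: lincomb_zero[OF e_Pi])

lemma Upsilon_span_add: "x \<in> Upsilon_span \<Longrightarrow> y \<in> Upsilon_span \<Longrightarrow> x \<oplus> y \<in> Upsilon_span"
proof -
  assume "x \<in> Upsilon_span" "y \<in> Upsilon_span"
  then obtain p q where pq: "Poly_Mapping.keys p \<subseteq> \<Upsilon> X" "x = lincomb A e p"
    "Poly_Mapping.keys q \<subseteq> \<Upsilon> X" "y = lincomb A e q"
    by (auto simp: Upsilon_span_def)
  then have "x \<oplus> y = lincomb A e (p + q)" by (simp add: lincomb_add[OF e_Pi])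
  moreover have "Poly_Mapping.keys (p + q) \<subseteq> \<Upsilon> X"
    using pq Poly_Mapping.keys_add[of p q] by blast
  ultimately show ?thesis by (auto simp: Upsilon_span_def)
qed

lemma Upsilon_span_smult: "x \<in> Upsilon_span \<Longrightarrow> c \<odot> x \<in> Upsilon_span"
proof -
  assume "x \<in> Upsilon_span"
  then obtain p where p: "Poly_Mapping.keys p \<subseteq> \<Upsilon> X" "x = lincomb A e p"
    by (auto simp: Upsilon_span_def)
  then have "c \<odot> x = lincomb A e (scale c p)" by (simp add: lincomb_scale[OF e_Pi])
  moreover have "Poly_Mapping.keys (scale c p) \<subseteq> \<Upsilon> X"
    using p keys_scale[of c p] by blast
  ultimately show ?thesis by (auto simp: Upsilon_span_def)
qed

lemma Upsilon_span_induct [consumes 1, case_names zero word add]: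
  assumes "x \<in> Upsilon_span"
    and zero: "R \<zero>" and word: "\<And>c w. w \<in> \<Upsilon> X \<Longrightarrow> R (c \<odot> e w)"
    and add: "\<And>x y. x \<in> Upsilon_span \<Longrightarrow> R x \<Longrightarrow> y \<in> Upsilon_span \<Longrightarrow> R y \<Longrightarrow> R (x \<oplus> y)"
  shows "R x"
proof -
  obtain p where p: "Poly_Mapping.keys p \<subseteq> \<Upsilon> X" "x = lincomb A e p"
    using assms(1) by (auto simp: Upsilon_span_def)
  from p(1) have "R (lincomb A e p)"
    by (induction p rule: poly_mapping_keys_induct)
      (auto simp: lincomb_zero[OF e_Pi] lincomb_single[OF e_Pi] lincomb_add[OF e_Pi] zero word Upsilon_span_def intro!: add)
  then show ?thesis by (simp add: p)
qed

lemma Upsilon_span_opP: "x \<in> Upsilon_span \<Longrightarrow> opP A x \<in> Upsilon_span"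
proof (induction rule: Upsilon_span_induct)
  case (word c w)
  have "opP A (e w) = e {#LP w#}"
    using eval_word_LP[OF f subsetD[OF Upsilon_Q word]] by simp
  then show ?case using word by (simp add: opP_smult e_Upsilon Upsilon_span_smult Upsilon_span_word Upsilon_LP)
qed (simp_all add: opP_zero Upsilon_span_zero opP_add Upsilon_span_closed Upsilon_span_add)

lemma Upsilon_span_base_mult: "a \<in> CS (D_omega X) \<Longrightarrow> x \<in> Upsilon_span \<Longrightarrow> e a \<otimes> x \<in> Upsilon_span"
proof -
  assume a: "a \<in> CS (D_omega X)"
  then have ea: "e a \<in> carrier A" by (simp add: e_closed CS_D_omega_Q)
  show "x \<in> Upsilon_span \<Longrightarrow> e a \<otimes> x \<in> Upsilon_span"
  proof (induction rule: Upsilon_span_induct)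
    case zero
    then show ?case using ea by (simp add: mult_comm[of _ \<zero>] mult_zero_left Upsilon_span_zero)
  next
    case (word c w)
    have "e a \<otimes> e w = e (a + w)"
      using eval_word_add[OF f CS_D_omega_Q[OF a]] word Upsilon_Q by (metis subsetD)
    then show ?case
      using word a ea by (simp add: mult_smult_right e_Upsilon Upsilon_span_smult Upsilon_span_word Upsilon_base_mult)
  next
    case (add x y)
    then show ?case using ea by (simp add: mult_add_right Upsilon_span_closed Upsilon_span_add)
  qed
qed

lemma e_LP: "v \<in> \<Upsilon> X \<Longrightarrow> e {#LP v#} = opP A (e v)"
  using eval_word_LP[OF f] Upsilon_Q by auto

lemma e_base_LP: "u \<in> CS (D_omega X) \<Longrightarrow> v \<in> \<Upsilon> X \<Longrightarrow> e (u + {#LP v#}) = e u \<otimes> opP A (e v)"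
  using eval_word_add[OF f, of u "{#LP v#}"] CS_D_omega_Q[of u X] Upsilon_LP[of v X] Upsilon_Q[of X] e_LP[of v]
  by (metis subsetD)

lemma level_Upsilon: "u \<in> \<Upsilon>_level X m \<Longrightarrow> u \<in> \<Upsilon> X"
  by (auto simp: \<Upsilon>_def)

text \<open>The measure is the sum of the levels. For \<open>P(u')P(v')\<close> of levels
  \<open>m = m' + 1\<close> and \<open>n = n' + 1\<close>, the products \<open>u'P(v')\<close>,
  \<open>P(u')v'\<close>, \<open>u'v'\<close> on the right of the Rota-Baxter identity have sums
  \<open>m' + n\<close>, \<open>m + n'\<close>, \<open>m' + n'\<close>, all smaller. Factors from
  \<open>CS (D_omega X)\<close> are moved in front, where the span absorbs them at no cost in
  level.\<close>

lemma Upsilon_span_mult_words: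
  "u \<in> \<Upsilon>_level X m \<Longrightarrow> v \<in> \<Upsilon>_level X n \<Longrightarrow> e u \<otimes> e v \<in> Upsilon_span"
proof (induction "m + n" arbitrary: u v m n rule: less_induct)
  case less
  note uv = level_Upsilon[OF less.prems(1)] level_Upsilon[OF less.prems(2)]
  have PP: "opP A (e u') \<otimes> opP A (e v') \<in> Upsilon_span"
    if "m = Suc m'" "n = Suc n'" "u' \<in> \<Upsilon>_level X m'" "v' \<in> \<Upsilon>_level X n'" for m' n' u' v'
  proof -
    note U = level_Upsilon[OF that(3)] level_Upsilon[OF that(4)]
    have "e u' \<otimes> e {#LP v'#} \<in> Upsilon_span"
      by (rule less.hyps[of m' n]) (use that in auto)
    moreover have "e {#LP u'#} \<otimes> e v' \<in> Upsilon_span"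
      by (rule less.hyps[of m n']) (use that in auto)
    moreover have "e u' \<otimes> e v' \<in> Upsilon_span"
      by (rule less.hyps[of m' n']) (use that in auto)
    ultimately show ?thesis
      using U by (simp add: rota_baxter e_Upsilon e_LP Upsilon_span_add Upsilon_span_opP Upsilon_span_smult)
  qed
  \<comment> \<open>A factor without \<open>P\<close> is absorbed from the right as well, by
    commutativity.\<close>
  have c: "e u \<otimes> e v \<in> Upsilon_span" if "v \<in> CS (D_omega X)"
    using Upsilon_span_base_mult[OF that Upsilon_span_word[OF uv(1)]] uv by (simp add: e_Upsilon mult_comm)
  show ?case
    using less.prems(1)
  proof (cases rule: Upsilon_level_cases)
    case base
    then show ?thesis by (simp add: Upsilon_span_base_mult Upsilon_span_word uv)
  next
    case u: (P m' u')
    note U = level_Upsilon[OF u(2)]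
    from less.prems(2) show ?thesis
    proof (cases rule: Upsilon_level_cases)
      case base
      then show ?thesis by (rule c)
    next
      case v: (P n' v')
      then show ?thesis using u U level_Upsilon[OF v(2)] PP by (simp add: e_LP)
    next
      case v: (mult n' b v')
      note V = level_Upsilon[OF v(3)]
      have "e b \<otimes> (opP A (e u') \<otimes> opP A (e v')) \<in> Upsilon_span"
        by (rule Upsilon_span_base_mult[OF v(2) PP[OF u(1) v(1) u(2) v(3)]])
      moreover have "e u \<otimes> e v = e b \<otimes> (opP A (e u') \<otimes> opP A (e v'))"
        using e_Upsilon[OF U] e_Upsilon[OF V] e_closed[OF CS_D_omega_Q[OF v(2)]]
        by (simp only: u(3) v(4) e_LP[OF U] e_base_LP[OF v(2) V])
          (simp add: mult_assoc[symmetric] opP_closed mult_comm[of _ "e b"])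
      ultimately show ?thesis by simp
    qed
  next
    case u: (mult m' a u')
    note U = level_Upsilon[OF u(3)]
    from less.prems(2) show ?thesis
    proof (cases rule: Upsilon_level_cases)
      case base
      then show ?thesis by (rule c)
    next
      case v: (P n' v')
      note V = level_Upsilon[OF v(2)]
      have "e a \<otimes> (opP A (e u') \<otimes> opP A (e v')) \<in> Upsilon_span"
        by (rule Upsilon_span_base_mult[OF u(2) PP[OF u(1) v(1) u(3) v(2)]])
      then show ?thesis
        using e_Upsilon[OF U] e_Upsilon[OF V] e_closed[OF CS_D_omega_Q[OF u(2)]]
        by (simp only: u(4) v(3) e_LP[OF V] e_base_LP[OF u(2) U])
          (simp add: mult_assoc opP_closed)
    next
      case v: (mult n' b v')
      note V = level_Upsilon[OF v(3)]
      have "e a \<otimes> (e b \<otimes> (opP A (e u') \<otimes> opP A (e v'))) \<in> Upsilon_span"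
        by (intro Upsilon_span_base_mult[OF u(2)] Upsilon_span_base_mult[OF v(2)] PP[OF u(1) v(1) u(3) v(3)])
      moreover have "e u \<otimes> e v = e a \<otimes> (e b \<otimes> (opP A (e u') \<otimes> opP A (e v')))"
        using e_Upsilon[OF U] e_Upsilon[OF V] e_closed[OF CS_D_omega_Q[OF u(2)]] e_closed[OF CS_D_omega_Q[OF v(2)]]
        by (simp only: u(4) v(4) e_base_LP[OF u(2) U] e_base_LP[OF v(2) V])
          (simp add: mult_assoc opP_closed mult_closed, simp add: mult_assoc[symmetric] opP_closed mult_comm[of _ "e b"])
      ultimately show ?thesis by simp
    qed
  qed
qed

lemma Upsilon_span_mult:
  assumes "x \<in> Upsilon_span" "y \<in> Upsilon_span" shows "x \<otimes> y \<in> Upsilon_span"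
  using assms(1)
proof (induction rule: Upsilon_span_induct)
  case zero
  then show ?case using assms(2) by (simp add: mult_zero_left Upsilon_span_closed Upsilon_span_zero)
next
  case (add x x')
  then show ?case using assms(2) by (simp add: mult_add_left Upsilon_span_closed Upsilon_span_add)
next
  case (word c u)
  note u = word
  show ?case using assms(2)
  proof (induction rule: Upsilon_span_induct)
    case zero
    then show ?case using u by (simp add: mult_comm[of _ \<zero>] mult_zero_left e_Upsilon Upsilon_span_zero)
  next
    case (add x x')
    then show ?case using u by (simp add: mult_add_right Upsilon_span_closed Upsilon_span_add e_Upsilon)
  next
    case (word d v)
    have "e u \<otimes> e v \<in> Upsilon_span"
      using u word Upsilon_span_mult_words by (auto simp: \<Upsilon>_def)
    then show ?case using u word
      by (simp add: mult_smult_left mult_smult_right e_Upsilon Upsilon_span_smult)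
  qed
qed

lemma Upsilon_span_opD_letter:
  assumes "y \<in> D_omega X" shows "opD A (e {#y#}) \<in> Upsilon_span"
proof -
  obtain i x where y: "x \<in> X" "y = D_power i x" using assms by (auto simp: D_omega_def)
  have "opD A (e {#y#}) = e {#D_power (Suc i) x#}"
    using eval_word_LD[OF f D_power_Q[OF y(1)]] by (simp add: y D_power_Suc)
  moreover have "{#D_power (Suc i) x#} \<in> CS (D_omega X)"
    using y(1) unfolding CS_def D_omega_def by auto
  ultimately show ?thesis by (simp add: Upsilon_span_word Upsilon_base)
qed

lemma Upsilon_span_opD_base: "a \<in> CS (D_omega X) \<Longrightarrow> opD A (e a) \<in> Upsilon_span"
proof (induction rule: CS_induct)
  case (add y v)
  then have y: "{#y#} \<in> CS (D_omega X)" by (simp add: CS_def)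
  have "e ({#y#} + v) = e {#y#} \<otimes> e v"
    by (rule eval_word_add[OF f CS_D_omega_Q[OF y] CS_D_omega_Q[OF add(2)]])
  then show ?case
    using y add Upsilon_span_opD_letter[of y] by (simp add: leibniz e_closed CS_D_omega_Q Upsilon_span_add Upsilon_span_mult Upsilon_span_smult Upsilon_span_word Upsilon_base del: union_mset_add_mset_left)
qed (rule Upsilon_span_opD_letter)

text \<open>Since \<open>D(P(v)) = v\<close>, the Leibniz rule reads
  \<open>D(uP(v)) = D(u)P(v) + uv + lam D(u)v\<close>. Every term is a product of elements of the
  span, so closure under products has to come before closure under \<open>D\<close>.\<close>

lemma Upsilon_span_opD: "x \<in> Upsilon_span \<Longrightarrow> opD A x \<in> Upsilon_span"
proof (induction rule: Upsilon_span_induct)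
  case (word c w)
  have "opD A (e w) \<in> Upsilon_span" using word
  proof (cases rule: Upsilon_cases)
    case base
    then show ?thesis by (rule Upsilon_span_opD_base)
  next
    case (P v)
    then show ?thesis by (simp add: e_LP opD_opP e_Upsilon Upsilon_span_word)
  next
    case (mult u v)
    then show ?thesis
      by (simp only: e_base_LP)
        (simp add: leibniz e_Upsilon opP_closed e_closed CS_D_omega_Q opD_opP Upsilon_span_add Upsilon_span_mult Upsilon_span_smult
          Upsilon_span_opD_base Upsilon_span_opP Upsilon_span_word Upsilon_base)
  qed
  then show ?case using word by (simp add: opD_smult e_Upsilon Upsilon_span_smult)
qed (simp_all add: opD_zero Upsilon_span_zero opD_add Upsilon_span_closed Upsilon_span_add)

lemma eval_word_in_span_Upsilon: "w \<in> \<Q> X \<Longrightarrow> e w \<in> Upsilon_span"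
proof (induction rule: Q_induct)
  case (Gen x)
  then have "{#Gen x#} \<in> CS (D_omega X)"
    by (auto simp: CS_def D_omega_def D_power_def intro!: exI[of _ 0] exI[of _ x])
  then show ?case by (simp add: Upsilon_span_word Upsilon_base)
qed (simp_all add: eval_word_LP[OF f] eval_word_LD[OF f] eval_word_add[OF f] Upsilon_span_opP Upsilon_span_opD Upsilon_span_mult)

end

section \<open>The presented algebra\<close>

context scalar_op_algebra begin

lemma span_induct [consumes 3, case_names zero word add]:
  assumes b: "b \<in> W \<rightarrow> carrier A" and p: "Poly_Mapping.keys p \<subseteq> W" and x: "x = lincomb A b p"
    and zero: "R \<zero>" and word: "\<And>c w. w \<in> W \<Longrightarrow> R (c \<odot> b w)"
    and add: "\<And>x y. x \<in> carrier A \<Longrightarrow> R x \<Longrightarrow> y \<in> carrier A \<Longrightarrow> R y \<Longrightarrow> R (x \<oplus> y)"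
  shows "R x"
  using p unfolding x
  by (induction p rule: poly_mapping_keys_induct)
    (auto simp: lincomb_zero[OF b] lincomb_single[OF b] lincomb_add[OF b] lincomb_closed[OF b] zero word intro!: add)

text \<open>The relations impose the identities only at words. Being linear in each argument, they
  extend to everything the words span.\<close>

lemma diff_rota_baxter_algebraI_span:
  assumes b: "b \<in> W \<rightarrow> carrier A"
    and span: "\<And>x. x \<in> carrier A \<Longrightarrow> \<exists>p. Poly_Mapping.keys p \<subseteq> W \<and> x = lincomb A b p"
    and rb: "\<And>u v. u \<in> W \<Longrightarrow> v \<in> W \<Longrightarrow> opP A (b u) \<otimes> opP A (b v)
        = opP A (b u \<otimes> opP A (b v)) \<oplus> opP A (opP A (b u) \<otimes> b v) \<oplus> lam \<odot> opP A (b u \<otimes> b v)"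
    and leibniz: "\<And>u v. u \<in> W \<Longrightarrow> v \<in> W \<Longrightarrow> opD A (b u \<otimes> b v)
        = (opD A (b u) \<otimes> b v) \<oplus> (b u \<otimes> opD A (b v)) \<oplus> lam \<odot> (opD A (b u) \<otimes> opD A (b v))"
    and DP: "\<And>u. u \<in> W \<Longrightarrow> opD A (opP A (b u)) = b u"
  shows "diff_rota_baxter_algebra scalar_ring lam A"
proof -
  have bc: "b w \<in> carrier A" if "w \<in> W" for w using b that by blast
  note cl = mult_closed opP_closed opD_closed bc
  have sr: "c \<odot> (x \<oplus> y) = c \<odot> x \<oplus> c \<odot> y" if "x \<in> carrier A" "y \<in> carrier A" for c x y
    using smult_r_distr[of c x y] that by simp
  have sz: "c \<odot> \<zero> = \<zero>" for c using smult_r_null[of c] by simp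
  have mzr: "x \<otimes> \<zero> = \<zero>" if "x \<in> carrier A" for x
    using that by (simp add: mult_comm[of x] mult_zero_left)
  have sc: "c \<odot> (d \<odot> x) = d \<odot> (c \<odot> x)" if "x \<in> carrier A" for c d x
    using that by (simp add: smult_mult[symmetric] mult.commute)
  note P = opP_add opP_smult[simplified] opP_zero and D = opD_add opD_smult[simplified] opD_zero
  note M = mult_add_left mult_add_right mult_zero_left mzr mult_smult_left[simplified] mult_smult_right
  have 1: "opP A x \<otimes> opP A y = opP A (x \<otimes> opP A y) \<oplus> opP A (opP A x \<otimes> y) \<oplus> lam \<odot> opP A (x \<otimes> y)"
    if x: "x \<in> carrier A" and y: "y \<in> carrier A" for x y
  proof -
    obtain p q where p: "Poly_Mapping.keys p \<subseteq> W" "x = lincomb A b p" and q: "Poly_Mapping.keys q \<subseteq> W" "y = lincomb A b q"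
      using span x y by blast
    from b p show ?thesis
    proof (induction rule: span_induct)
      case (word c u)
      from b q show ?case
      proof (induction rule: span_induct)
        case (word d v)
        then show ?case using \<open>u \<in> W\<close> by (simp add: P M cl rb sr sc[of _ lam])
      qed (use word in \<open>simp_all add: P M cl sr sz M.a_ac\<close>)
    qed (use y in \<open>simp_all add: P M cl sr sz M.a_ac\<close>)
  qed
  have 2: "opD A (x \<otimes> y) = (opD A x \<otimes> y) \<oplus> (x \<otimes> opD A y) \<oplus> lam \<odot> (opD A x \<otimes> opD A y)"
    if x: "x \<in> carrier A" and y: "y \<in> carrier A" for x y
  proof -
    obtain p q where p: "Poly_Mapping.keys p \<subseteq> W" "x = lincomb A b p" and q: "Poly_Mapping.keys q \<subseteq> W" "y = lincomb A b q"
      using span x y by blast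
    from b p show ?thesis
    proof (induction rule: span_induct)
      case (word c u)
      from b q show ?case
      proof (induction rule: span_induct)
        case (word d v)
        then show ?case using \<open>u \<in> W\<close> by (simp add: D M cl leibniz sr sc[of _ lam])
      qed (use word in \<open>simp_all add: D M cl sr sz M.a_ac\<close>)
    qed (use y in \<open>simp_all add: D M cl sr sz M.a_ac\<close>)
  qed
  have 3: "opD A (opP A x) = x" if x: "x \<in> carrier A" for x
  proof -
    obtain p where p: "Poly_Mapping.keys p \<subseteq> W" "x = lincomb A b p"
      using span x by blast
    from b p show ?thesis
      by (induction rule: span_induct) (simp_all add: P D cl DP)
  qed
  show ?thesis
    by unfold_locales (use 1 2 3 in simp_all)
qed

end

locale drb_presentation =
  fixes lam :: "'k::{comm_ring, comm_monoid_mult}" and X :: "'x set"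
begin

abbreviation "F \<equiv> free_op_algebra X :: ('k, 'x word \<Rightarrow>\<^sub>0 'k) op_algebra"
abbreviation "I \<equiv> drb_ideal lam X"
abbreviation "B \<equiv> drb_quotient lam X"
abbreviation "\<pi> p \<equiv> I +>\<^bsub>F\<^esub> p"
abbreviation "\<eta> x \<equiv> word_class lam X {#Gen x#}"
abbreviation "\<xi> \<equiv> eval_word B \<eta>"

lemma op_ideal_I: "op_ideal scalar_ring F I"
  unfolding drb_ideal_def
  by (rule comm_op_algebra.op_ideal_op_ideal_generated[OF comm_op_algebra_free drb_relations_carrier])

lemma relations_I: "drb_relations lam X \<subseteq> I"
  by (auto simp: drb_ideal_def op_ideal_generated_def)

lemmas quotient_ops = comm_op_algebra.op_quotient_ops[OF comm_op_algebra_free op_ideal_I, folded drb_quotient_def, simplified]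

lemma carrier_B: "carrier B = \<pi> ` carrier F"
  unfolding drb_quotient_def
  by (rule comm_op_algebra.carrier_op_quotient[OF comm_op_algebra_free op_ideal_I])

sublocale scalar_op_algebra B
  by (rule scalar_op_algebra.intro)
    (unfold drb_quotient_def, rule comm_op_algebra.comm_op_algebra_quotient[OF comm_op_algebra_free op_ideal_I])

lemma pi_hom: "\<pi> \<in> op_algebra_hom scalar_ring F B"
  unfolding drb_quotient_def
  by (rule comm_op_algebra.op_quotient_hom[OF comm_op_algebra_free op_ideal_I])

lemma eta_closed: "\<eta> \<in> X \<rightarrow> carrier B"
  by (auto simp: carrier_B word_class_def word_mon_def Q_Gen)

text \<open>The quotient map and evaluation at the classes of the generators are morphisms from
  \<open>K[X;\<Omega>]\<close> that agree on generators, hence they coincide. All facts about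
  evaluation thereby apply to cosets.\<close>

lemma pi_lincomb: "Poly_Mapping.keys p \<subseteq> \<Q> X \<Longrightarrow> \<pi> p = lincomb B \<xi> p"
  by (rule op_algebra_hom_free_unique[OF eta_closed pi_hom]) (simp_all add: word_class_def)

lemma eval_word_B: "w \<in> \<Q> X \<Longrightarrow> \<xi> w = \<pi> (word_mon w)"
  using pi_lincomb[of "word_mon w"] lincomb_eval_word_mon[OF eta_closed] by (simp add: keys_Q_closed)

lemma pi_eqI:
  assumes "Poly_Mapping.keys p \<subseteq> \<Q> X" "Poly_Mapping.keys q \<subseteq> \<Q> X" "p - q \<in> I"
  shows "\<pi> p = \<pi> q"
  using comm_op_algebra.coset_absorb[OF comm_op_algebra_free op_ideal_I assms(3), of q] assms by simp

lemma diff_rota_baxter_algebra_B: "diff_rota_baxter_algebra scalar_ring lam B"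
proof (rule diff_rota_baxter_algebraI_span)
  show "\<xi> \<in> \<Q> X \<rightarrow> carrier B"
    using eval_word_closed[OF eta_closed] by blast
  show "\<exists>p. Poly_Mapping.keys p \<subseteq> \<Q> X \<and> x = lincomb B \<xi> p" if "x \<in> carrier B" for x
    using that by (auto simp: carrier_B pi_lincomb)
  fix u assume u: "u \<in> \<Q> X"
  note r = subsetD[OF relations_I drb_relationsI(1)[OF u]] subsetD[OF relations_I drb_relationsI(2)[OF u]]
    subsetD[OF relations_I drb_relationsI(3)[OF u]]
  show "opD B (opP B (\<xi> u)) = \<xi> u"
    using u pi_eqI[OF _ _ r(3)] by (simp add: eval_word_B keys_Q_closed quotient_ops)
  fix v assume v: "v \<in> \<Q> X"
  show "opP B (\<xi> u) \<otimes>\<^bsub>B\<^esub> opP B (\<xi> v) = opP B (\<xi> u \<otimes>\<^bsub>B\<^esub> opP B (\<xi> v)) \<oplus>\<^bsub>B\<^esub> opP B (opP B (\<xi> u) \<otimes>\<^bsub>B\<^esub> \<xi> v)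
      \<oplus>\<^bsub>B\<^esub> lam \<odot>\<^bsub>B\<^esub> opP B (\<xi> u \<otimes>\<^bsub>B\<^esub> \<xi> v)"
    using u v pi_eqI[OF _ _ r(1)[OF v]] by (simp add: eval_word_B keys_Q_closed quotient_ops add.assoc)
  show "opD B (\<xi> u \<otimes>\<^bsub>B\<^esub> \<xi> v) = (opD B (\<xi> u) \<otimes>\<^bsub>B\<^esub> \<xi> v) \<oplus>\<^bsub>B\<^esub> (\<xi> u \<otimes>\<^bsub>B\<^esub> opD B (\<xi> v))
      \<oplus>\<^bsub>B\<^esub> lam \<odot>\<^bsub>B\<^esub> (opD B (\<xi> u) \<otimes>\<^bsub>B\<^esub> opD B (\<xi> v))"
    using u v pi_eqI[OF _ _ r(2)[OF v]] by (simp add: eval_word_B keys_Q_closed quotient_ops add.assoc)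
qed

lemma ex1_hom:
  assumes R: "diff_rota_baxter_algebra scalar_ring lam R" and f: "f \<in> X \<rightarrow> carrier R"
  shows "\<exists>!h. h \<in> extensional (carrier B) \<and> h \<in> op_algebra_hom scalar_ring B R \<and> (\<forall>x\<in>X. h (\<eta> x) = f x)"
proof -
  interpret R: diff_rota_baxter_algebra scalar_ring lam R by fact
  interpret R: scalar_op_algebra R by unfold_locales
  let ?E = "lincomb R (eval_word R f)"
  note hom = R.lincomb_eval_word_hom[OF f]
  note hD = op_algebra_homD[OF hom, simplified]
  \<comment> \<open>Any representative will do: two of them differ by an element of the ideal, on
    which evaluation in \<open>R\<close> vanishes.\<close>
  define h where "h = restrict (\<lambda>C. ?E (SOME p. p \<in> C)) (carrier B)"
  have h: "h (\<pi> p) = ?E p" if p: "Poly_Mapping.keys p \<subseteq> \<Q> X" for p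
  proof -
    interpret S: abelian_subgroup I F
      by (rule comm_op_algebra.op_ideal_abelian_subgroup[OF comm_op_algebra_free op_ideal_I])
    have "p \<in> \<pi> p" using p by (simp add: S.a_rcos_self)
    then have "(SOME q. q \<in> \<pi> p) \<in> \<pi> p" by (rule someI)
    then obtain i where i: "i \<in> I" "(SOME q. q \<in> \<pi> p) = i + p"
      by (auto simp: a_r_coset_def')
    have "Poly_Mapping.keys i \<subseteq> \<Q> X" using S.a_subset i(1) by auto
    then have "?E (i + p) = ?E p"
      using p hD(1,2) lincomb_eval_word_drb_ideal[OF R f i(1)] by simp
    then show ?thesis using p by (simp add: h_def i(2) carrier_B)
  qed
  have h_hom: "h \<in> op_algebra_hom scalar_ring B R"
    by (rule op_algebra_homI) (auto simp: carrier_B h hD quotient_ops keys_Q_closed)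
  have h_eta: "h (\<eta> x) = f x" if "x \<in> X" for x
    using that h[of "word_mon {#Gen x#}"]
    by (simp add: word_class_def keys_Q_closed Q_Gen R.lincomb_eval_word_mon[OF f] R.eval_word_Gen[OF f])
  have unique: "h' = h" if "h' \<in> extensional (carrier B)" and h': "h' \<in> op_algebra_hom scalar_ring B R"
    and "\<forall>x\<in>X. h' (\<eta> x) = f x" for h'
  proof (rule extensionalityI[of _ "carrier B"])
    note pD = op_algebra_homD[OF pi_hom, simplified] and h'D = op_algebra_homD[OF h', simplified]
    \<comment> \<open>Uniqueness descends from \<open>K[X;\<Omega>]\<close> by composing with the
      surjection \<open>\<pi>\<close>.\<close>
    have "(\<lambda>p. h' (\<pi> p)) \<in> op_algebra_hom scalar_ring F R"
      by (rule op_algebra_homI) (simp_all add: pD h'D)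
    then have "h' (\<pi> p) = ?E p" if "Poly_Mapping.keys p \<subseteq> \<Q> X" for p
      using that \<open>\<forall>x\<in>X. h' (\<eta> x) = f x\<close> R.op_algebra_hom_free_unique[OF f, of "\<lambda>p. h' (\<pi> p)" p]
      by (simp add: word_class_def)
    then show "h' C = h C" if "C \<in> carrier B" for C
      using that by (auto simp: carrier_B h)
  qed (use that h_def in auto)
  show ?thesis
    using h_hom h_eta unique by (intro ex1I[of _ h]) (auto simp: h_def)
qed

lemma word_class_eval: "w \<in> \<Q> X \<Longrightarrow> word_class lam X w = \<xi> w"
  by (simp only: eval_word_B word_class_def[of _ _ w])

lemma span_Upsilon:
  assumes "a \<in> carrier B"
  shows "\<exists>q. Poly_Mapping.keys q \<subseteq> \<Upsilon> X \<and> a = lincomb B (word_class lam X) q"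
proof -
  interpret D: diff_rota_baxter_algebra scalar_ring lam B by (rule diff_rota_baxter_algebra_B)
  interpret E: evaluated_drb lam B X \<eta>
    by unfold_locales (rule eta_closed)
  obtain p where p: "Poly_Mapping.keys p \<subseteq> \<Q> X" "a = \<pi> p" using assms by (auto simp: carrier_B)
  have "lincomb B \<xi> p \<in> E.Upsilon_span"
    using eval_word_Pi[OF eta_closed] p(1) refl
    by (induction rule: span_induct) (auto intro: E.Upsilon_span_zero E.Upsilon_span_smult E.Upsilon_span_add E.eval_word_in_span_Upsilon)
  then obtain q where q: "Poly_Mapping.keys q \<subseteq> \<Upsilon> X" "a = lincomb B \<xi> q"
    using p pi_lincomb by (auto simp: E.Upsilon_span_def)
  moreover have "lincomb B \<xi> q = lincomb B (word_class lam X) q"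
    unfolding lincomb_def using q Upsilon_Q[of X] eval_word_closed[OF eta_closed]
    by (intro M.finsum_cong') (auto simp: word_class_eval subset_iff)
  ultimately show ?thesis by auto
qed

end

section \<open>Quasi-shuffle algebras\<close>

text \<open>The coproduct dual to addition of multisets. Its finiteness is what allows arbitrary
  functions to be convolved.\<close>

definition splits :: "'m multiset \<Rightarrow> ('m multiset \<times> 'm multiset) set" where
  "splits a = {(b, c). b + c = a}"

lemma finite_splits [simp]: "finite (splits a)"
proof -
  have "splits a \<subseteq> (\<lambda>b. (b, a - b)) ` (\<Union>n\<le>size a. multisets_of_size (set_mset a) n)"
    by (force simp: splits_def multisets_of_size_def)
  then show ?thesis
    by (rule finite_subset) (auto simp: finite_multisets_of_size)
qed

lemma splits_swap: "(\<Sum>(b, c)\<in>splits a. h b c) = (\<Sum>(b, c)\<in>splits a. h c b)"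
  by (rule sum.reindex_bij_witness[of _ prod.swap prod.swap]) (auto simp: splits_def add.commute)

text \<open>Coassociativity: both sides run over the decompositions of \<open>a\<close> into three
  parts, with \<open>((b, c), (d, e))\<close> on the left matching
  \<open>((d, e + c), (e, c))\<close> on the right.\<close>

lemma splits_assoc:
  "(\<Sum>(b, c)\<in>splits a. \<Sum>(d, e)\<in>splits b. h d e c) = (\<Sum>(b, c)\<in>splits a. \<Sum>(d, e)\<in>splits c. h b d e)"
proof -
  have "(\<Sum>(b, c)\<in>splits a. \<Sum>(d, e)\<in>splits b. h d e c)
      = (\<Sum>p\<in>(SIGMA p:splits a. splits (fst p)). h (fst (snd p)) (snd (snd p)) (snd (fst p)))"
    by (simp add: sum.Sigma case_prod_beta)
  also have "\<dots> = (\<Sum>p\<in>(SIGMA p:splits a. splits (snd p)). h (fst (fst p)) (fst (snd p)) (snd (snd p)))"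
    by (rule sum.reindex_bij_witness[of _
          "\<lambda>p. ((fst (fst p) + fst (snd p), snd (snd p)), (fst (fst p), fst (snd p)))"
          "\<lambda>p. ((fst (snd p), snd (snd p) + snd (fst p)), (snd (snd p), snd (fst p)))"])
       (auto simp: splits_def add.assoc)
  also have "\<dots> = (\<Sum>(b, c)\<in>splits a. \<Sum>(d, e)\<in>splits c. h b d e)"
    by (simp add: sum.Sigma case_prod_beta)
  finally show ?thesis .
qed

lemma splits_empty [simp]: "splits {#} = {({#}, {#})}"
  by (auto simp: splits_def)

text \<open>Here the algebra is a whole type. Functions into it again form a type, so the layers of
  the model can be stacked without carrier conditions.\<close>

locale comm_alg =
  fixes scl :: "'k::{comm_ring, comm_monoid_mult} \<Rightarrow> 'a::ab_group_add \<Rightarrow> 'a"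
    and mul :: "'a \<Rightarrow> 'a \<Rightarrow> 'a"
  assumes scl_add_left: "scl (c + d) x = scl c x + scl d x"
    and scl_add_right: "scl c (x + y) = scl c x + scl c y"
    and scl_scl: "scl c (scl d x) = scl (c * d) x"
    and scl_one: "scl 1 x = x"
    and mul_assoc: "mul (mul x y) z = mul x (mul y z)"
    and mul_commute: "mul x y = mul y x"
    and mul_add_left: "mul (x + y) z = mul x z + mul y z"
    and mul_scl_left: "mul (scl c x) y = scl c (mul x y)"
begin

lemma mul_add_right: "mul x (y + z) = mul x y + mul x z"
  by (metis mul_add_left mul_commute)

lemma mul_zero_left [simp]: "mul 0 y = 0"
  using mul_add_left[of 0 0 y] by simp

lemma mul_zero_right [simp]: "mul x 0 = 0"
  by (metis mul_zero_left mul_commute)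

lemma scl_zero_right [simp]: "scl c 0 = 0"
  using scl_add_right[of c 0 0] by simp

lemma mul_sum_left: "mul (\<Sum>i\<in>I. f i) y = (\<Sum>i\<in>I. mul (f i) y)"
  by (induction I rule: infinite_finite_induct) (auto simp: mul_add_left)

lemma mul_sum_right: "mul y (\<Sum>i\<in>I. f i) = (\<Sum>i\<in>I. mul y (f i))"
  by (induction I rule: infinite_finite_induct) (auto simp: mul_add_right)

lemma scl_sum: "scl c (\<Sum>i\<in>I. f i) = (\<Sum>i\<in>I. scl c (f i))"
  by (induction I rule: infinite_finite_induct) (auto simp: scl_add_right)

end

text \<open>Multisets are monomials, so this is the multiplication of formal power series in
  commuting variables, with coefficients in an arbitrary algebra.\<close>

definition conv :: "('a::ab_group_add \<Rightarrow> 'a \<Rightarrow> 'a) \<Rightarrow> ('m multiset \<Rightarrow> 'a) \<Rightarrow> ('m multiset \<Rightarrow> 'a) \<Rightarrow> 'm multiset \<Rightarrow> 'a" where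
  "conv mul f g a = (\<Sum>(b, c)\<in>splits a. mul (f b) (g c))"

lemma comm_alg_conv:
  assumes "comm_alg scl mul"
  shows "comm_alg (\<lambda>c f x. scl c (f x)) (conv mul)"
proof -
  interpret comm_alg scl mul by fact
  show ?thesis
  proof
    fix f g h :: "'c multiset \<Rightarrow> 'b"
    show "conv mul (conv mul f g) h = conv mul f (conv mul g h)"
    proof
      fix a
      have "conv mul (conv mul f g) h a = (\<Sum>(b, c)\<in>splits a. \<Sum>(d, e)\<in>splits b. mul (f d) (mul (g e) (h c)))"
        by (simp add: conv_def mul_sum_left case_prod_beta mul_assoc)
      also have "\<dots> = (\<Sum>(b, c)\<in>splits a. \<Sum>(d, e)\<in>splits c. mul (f b) (mul (g d) (h e)))"
        by (rule splits_assoc)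
      also have "\<dots> = conv mul f (conv mul g h) a"
        by (simp add: conv_def mul_sum_right case_prod_beta)
      finally show "conv mul (conv mul f g) h a = conv mul f (conv mul g h) a" .
    qed
    show "conv mul f g = conv mul g f"
      by (rule ext) (subst conv_def, subst splits_swap, simp add: conv_def mul_commute)
  qed (auto simp: fun_eq_iff conv_def scl_add_left scl_add_right scl_scl scl_one mul_add_left mul_scl_left
        scl_sum case_prod_beta sum.distrib)
qed

text \<open>
  The quasi-shuffle product of functions on words, i.e. of formal series. Each series is determined by
  its value at \<^term>\<open>[]\<close> and its left derivatives \<open>\<partial>\<^sub>a\<close> (\<open>left_deriv a\<close> below), and the product is the one with
  \<open>\<partial>\<^sub>a(f \<star> g) = \<partial>\<^sub>a f \<star> g + f \<star> \<partial>\<^sub>a g + \<lambda> (\<Sum>b+c=a. \<partial>\<^sub>b f \<star> \<partial>\<^sub>c g)\<close>. This makes its laws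
  provable by induction on the word at which both sides are evaluated.
\<close>

primrec qsh :: "('k \<Rightarrow> 'a \<Rightarrow> 'a) \<Rightarrow> ('a \<Rightarrow> 'a \<Rightarrow> 'a) \<Rightarrow> 'k \<Rightarrow> 'm multiset list \<Rightarrow>
    ('m multiset list \<Rightarrow> 'a) \<Rightarrow> ('m multiset list \<Rightarrow> 'a) \<Rightarrow> 'a::ab_group_add" where
  "qsh scl mul lam [] f g = mul (f []) (g [])"
| "qsh scl mul lam (a # w) f g = qsh scl mul lam w (\<lambda>v. f (a # v)) g + qsh scl mul lam w f (\<lambda>v. g (a # v))
     + scl lam (\<Sum>(b, c)\<in>splits a. qsh scl mul lam w (\<lambda>v. f (b # v)) (\<lambda>v. g (c # v)))"

definition qshuffle :: "('k \<Rightarrow> 'a \<Rightarrow> 'a) \<Rightarrow> ('a \<Rightarrow> 'a \<Rightarrow> 'a) \<Rightarrow> 'k \<Rightarrow>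
    ('m multiset list \<Rightarrow> 'a) \<Rightarrow> ('m multiset list \<Rightarrow> 'a) \<Rightarrow> 'm multiset list \<Rightarrow> 'a::ab_group_add" where
  "qshuffle scl mul lam f g w = qsh scl mul lam w f g"

definition left_deriv :: "'m multiset \<Rightarrow> ('m multiset list \<Rightarrow> 'a) \<Rightarrow> 'm multiset list \<Rightarrow> 'a" where
  "left_deriv a f = (\<lambda>w. f (a # w))"

lemma qshuffle_Nil [simp]: "qshuffle scl mul lam f g [] = mul (f []) (g [])"
  by (simp add: qshuffle_def)

lemma qshuffle_Cons: "qshuffle scl mul lam f g (a # w) = qshuffle scl mul lam (left_deriv a f) g w
    + qshuffle scl mul lam f (left_deriv a g) w
     + scl lam (\<Sum>(b, c)\<in>splits a. qshuffle scl mul lam (left_deriv b f) (left_deriv c g) w)"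
  by (simp add: qshuffle_def left_deriv_def)

lemma left_deriv_add [simp]: "left_deriv a (f + g) = left_deriv a f + left_deriv a g"
  by (auto simp: left_deriv_def)

lemma sum_fun_apply: "(\<Sum>i\<in>I. f i) x = (\<Sum>i\<in>I. f i x :: 'a :: comm_monoid_add)"
  by (induction I rule: infinite_finite_induct) auto

context comm_alg begin

context fixes lam :: 'k begin

abbreviation qs (infixl "\<star>" 70) where "f \<star> g \<equiv> qshuffle scl mul lam f g"

lemma left_deriv_qshuffle: "left_deriv a (f \<star> g) = left_deriv a f \<star> g + f \<star> left_deriv a g + (\<Sum>(b, c)\<in>splits a. (\<lambda>w. scl lam ((left_deriv b f \<star> left_deriv c g) w)))"
  by (rule ext) (simp add: left_deriv_def[of a "f \<star> g"] qshuffle_Cons sum_fun_apply case_prod_beta scl_sum)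

lemma qshuffle_add_left: "((f + g) \<star> h) w = (f \<star> h) w + (g \<star> h) w"
proof (induction w arbitrary: f g h)
  case (Cons a w)
  show ?case
    by (simp add: qshuffle_Cons Cons case_prod_beta sum.distrib scl_add_right algebra_simps
        del: plus_fun_apply)
qed (simp add: mul_add_left)

lemma qshuffle_scl_left: "((\<lambda>w. scl c (f w)) \<star> h) w = scl c ((f \<star> h) w)"
proof (induction w arbitrary: f h)
  case (Cons a w)
  have *: "left_deriv a (\<lambda>w. scl c (f w)) = (\<lambda>w. scl c (left_deriv a f w))" for a and f :: "'m multiset list \<Rightarrow> 'a"
    by (simp add: left_deriv_def)
  show ?case unfolding qshuffle_Cons *
    by (simp add: Cons case_prod_beta scl_sum scl_add_right scl_scl mult.commute)
qed (simp add: mul_scl_left)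

lemma qshuffle_commute: "f \<star> g = g \<star> f"
proof
  fix w show "(f \<star> g) w = (g \<star> f) w"
  proof (induction w arbitrary: f g)
    case (Cons a w)
    have "(\<Sum>(b, c)\<in>splits a. (left_deriv b f \<star> left_deriv c g) w) = (\<Sum>(b, c)\<in>splits a. (left_deriv c f \<star> left_deriv b g) w)"
      by (rule splits_swap)
    also have "\<dots> = (\<Sum>(b, c)\<in>splits a. (left_deriv b g \<star> left_deriv c f) w)"
      by (simp add: Cons)
    finally show ?case
      by (simp add: qshuffle_Cons Cons[of f] Cons[of "left_deriv a f"] add.commute)
  qed (simp add: mul_commute)
qed

lemma qshuffle_add_right: "(h \<star> (f + g)) w = (h \<star> f) w + (h \<star> g) w"
  by (metis qshuffle_add_left qshuffle_commute)

lemma qshuffle_scl_right: "(h \<star> (\<lambda>w. scl c (f w))) w = scl c ((h \<star> f) w)"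
  by (metis qshuffle_scl_left qshuffle_commute)

lemma qshuffle_zero_left: "(0 \<star> h) w = 0"
  using qshuffle_add_left[of 0 0 h] by simp

lemma qshuffle_sum_left: "((\<Sum>i\<in>I. f i) \<star> h) w = (\<Sum>i\<in>I. (f i \<star> h) w)"
  by (induction I rule: infinite_finite_induct)
    (simp_all add: qshuffle_zero_left qshuffle_add_left del: plus_fun_apply zero_fun_apply)

lemma qshuffle_sum_right: "(h \<star> (\<Sum>i\<in>I. f i)) w = (\<Sum>i\<in>I. (h \<star> f i) w)"
  using qshuffle_sum_left[of f I h] by (simp add: qshuffle_commute[of h])

lemma qshuffle_assoc: "(f \<star> g) \<star> h = f \<star> (g \<star> h)"
proof
  fix w show "((f \<star> g) \<star> h) w = (f \<star> (g \<star> h)) w"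
  proof (induction w arbitrary: f g h)
    case (Cons a w)
    \<comment> \<open>These are the terms of order two in \<open>lam\<close>, where \<open>a\<close>
      is split into three parts in two different bracketings. The remaining terms match one by one
      through the induction hypothesis.\<close>
    have "(\<Sum>(b, c)\<in>splits a. \<Sum>(d, e)\<in>splits b. scl lam ((left_deriv d f \<star> (left_deriv e g \<star> left_deriv c h)) w)) =
      (\<Sum>(b, c)\<in>splits a. \<Sum>(d, e)\<in>splits c. scl lam ((left_deriv b f \<star> (left_deriv d g \<star> left_deriv e h)) w))"
      by (rule splits_assoc)
    then show ?case
      by (simp add: qshuffle_Cons left_deriv_qshuffle qshuffle_add_left qshuffle_add_right qshuffle_scl_left qshuffle_scl_right
          qshuffle_sum_left qshuffle_sum_right Cons case_prod_beta scl_add_right sum.distrib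
          scl_sum[symmetric] add_ac del: plus_fun_apply)
  qed (simp add: mul_assoc)
qed

lemma comm_alg_qshuffle: "comm_alg (\<lambda>c f w. scl c (f w)) (qshuffle scl mul lam)"
  by unfold_locales
    (auto simp: scl_add_left scl_add_right scl_scl scl_one qshuffle_assoc qshuffle_add_left qshuffle_scl_left
      intro: qshuffle_commute)

end
end

context comm_alg begin

text \<open>A \<open>g\<close> supported at \<open>{#}\<close> is a constant power series and acts
  coefficientwise. All values of \<open>prefix_op\<close> are of this kind.\<close>

lemma conv_right_const:
  assumes "\<And>c. c \<noteq> {#} \<Longrightarrow> g c = 0"
  shows "conv mul f g a = mul (f a) (g {#})"
proof -
  have *: "mul (f b) (g c) = 0" if "c \<noteq> {#}" for b c
    using that assms by simp
  have "conv mul f g a = (\<Sum>(b, c)\<in>{(a, {#})}. mul (f b) (g c))"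
    unfolding conv_def by (intro sum.mono_neutral_right finite_splits) (auto simp: splits_def intro!: *)
  then show ?thesis by simp
qed

lemma conv_single:
  assumes "\<And>d. d \<noteq> a \<Longrightarrow> f d = 0" and "\<And>e. e \<noteq> b \<Longrightarrow> g e = 0"
  shows "conv mul f g c = (if c = a + b then mul (f a) (g b) else 0)"
proof -
  have *: "mul (f d) (g e) = 0" if "d \<noteq> a \<or> e \<noteq> b" for d e
    using that assms by auto
  show ?thesis
  proof (cases "c = a + b")
    case True
    have "conv mul f g c = (\<Sum>(d, e)\<in>{(a, b)}. mul (f d) (g e))"
      unfolding conv_def using True * by (intro sum.mono_neutral_right finite_splits) (auto simp: splits_def)
    then show ?thesis by (simp add: True)
  next
    case False
    then show ?thesis
      unfolding conv_def by (auto simp: splits_def intro!: sum.neutral *)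
  qed
qed

end

section \<open>Rota-Baxter operators on quasi-shuffle algebras\<close>

definition rota_baxter_op :: "('k \<Rightarrow> 'a::ab_group_add \<Rightarrow> 'a) \<Rightarrow> ('a \<Rightarrow> 'a \<Rightarrow> 'a) \<Rightarrow> 'k \<Rightarrow> ('a \<Rightarrow> 'a) \<Rightarrow> bool" where
  "rota_baxter_op scl mul lam P \<longleftrightarrow> (\<forall>x y. P (x + y) = P x + P y) \<and> (\<forall>c x. P (scl c x) = scl c (P x)) \<and>
     (\<forall>x y. mul (P x) (P y) = P (mul x (P y)) + P (mul (P x) y) + scl lam (P (mul x y)))"

text \<open>
  A function \<open>f\<close> of a letter and a word stands for the series of the \<open>f a w \<cdot> a \<otimes> w\<close>, and \<open>P\<close> sends
  \<open>a \<otimes> w\<close> to \<open>1 \<otimes> aw\<close>.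
\<close>

definition prefix_op :: "('m multiset \<Rightarrow> 'm multiset list \<Rightarrow> 'a::zero) \<Rightarrow> 'm multiset \<Rightarrow> 'm multiset list \<Rightarrow> 'a" where
  "prefix_op f a w = (if a = {#} then case w of [] \<Rightarrow> 0 | b # v \<Rightarrow> f b v else 0)"

text \<open>
  On series, \<open>\<partial>\<^sub>a\<close> for the letter \<open>a = {#}\<close> is a derivation of weight \<open>\<lambda>\<close>, since \<^term>\<open>{#}\<close> splits only
  as \<^term>\<open>{#} + {#}\<close>. It plays the role of \<open>D\<close>, and the other letters are idle: words in \<^term>\<open>{#}\<close>
  alone would give the \<open>\<lambda>\<close>-Hurwitz series.
\<close>

definition lift_op :: "('a \<Rightarrow> 'a) \<Rightarrow> ('m multiset list \<Rightarrow> 'a::zero) \<Rightarrow> 'm multiset list \<Rightarrow> 'a" where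
  "lift_op P f w = (case w of [] \<Rightarrow> P (f []) | a # v \<Rightarrow> if a = {#} then f v else 0)"

context comm_alg begin
context fixes lam :: 'k begin

text \<open>The identity is the recursion of the product. \<open>prefix_op f\<close> is supported at
  \<open>{#}\<close>, and there its left derivative by \<open>b\<close> is \<open>f b\<close>; so
  the three terms of \<open>qshuffle_Cons\<close> at \<open>b # v\<close> are the three terms
  required, the sum over splits being the convolution of \<open>f\<close> and \<open>g\<close> at
  \<open>b\<close>.\<close>

lemma rota_baxter_prefix_op:
  "rota_baxter_op (\<lambda>c f a w. scl c (f a w)) (conv (qshuffle scl mul lam)) lam
     (prefix_op :: ('m multiset \<Rightarrow> 'm multiset list \<Rightarrow> 'a) \<Rightarrow> _)"
proof -
  interpret qs: comm_alg "\<lambda>c f w. scl c (f w)" "qshuffle scl mul lam"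
    by (rule comm_alg_qshuffle)
  let ?m = "qshuffle scl mul lam"
  have left_deriv: "left_deriv b (prefix_op f {#}) = f b" for f :: "'m multiset \<Rightarrow> 'm multiset list \<Rightarrow> 'a" and b
    by (simp add: left_deriv_def prefix_op_def)
  have ne: "prefix_op f a = 0" if "a \<noteq> {#}" for f :: "'m multiset \<Rightarrow> 'm multiset list \<Rightarrow> 'a" and a
    using that by (auto simp: prefix_op_def)
  have cr: "conv ?m f (prefix_op g) a = ?m (f a) (prefix_op g {#})"
    for f g :: "'m multiset \<Rightarrow> 'm multiset list \<Rightarrow> 'a" and a
    by (rule qs.conv_right_const) (rule ne)
  have cl: "conv ?m (prefix_op g) f a = ?m (prefix_op g {#}) (f a)"
    for f g :: "'m multiset \<Rightarrow> 'm multiset list \<Rightarrow> 'a" and a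
    using cr[of f g a] comm_alg.mul_commute[OF comm_alg_conv[OF qs.comm_alg_axioms]] qs.mul_commute
    by metis
  have "conv ?m (prefix_op f) (prefix_op g) a w =
     (prefix_op (conv ?m f (prefix_op g)) + prefix_op (conv ?m (prefix_op f) g)) a w
     + scl lam (prefix_op (conv ?m f g) a w)" for f g :: "'m multiset \<Rightarrow> 'm multiset list \<Rightarrow> 'a" and a w
  proof (cases "a = {#}")
    case [simp]: True
    show ?thesis
    proof (cases w)
      case Nil
      then show ?thesis by (simp add: cr prefix_op_def)
    next
      case (Cons b v)
      have "conv ?m (prefix_op f) (prefix_op g) a w = ?m (prefix_op f {#}) (prefix_op g {#}) (b # v)"
        by (simp add: cr Cons)
      also have "\<dots> = ?m (f b) (prefix_op g {#}) v + ?m (prefix_op f {#}) (g b) v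
         + scl lam (\<Sum>(b, c)\<in>splits b. ?m (f b) (g c) v)"
        by (simp add: qshuffle_Cons left_deriv)
      finally show ?thesis
        by (simp add: Cons prefix_op_def[of "conv _ _ _"] cr cl)
           (simp add: conv_def sum_fun_apply case_prod_beta)
    qed
  next
    case False
    then show ?thesis by (simp add: cr ne)
  qed
  then show ?thesis
    unfolding rota_baxter_op_def
    by (auto simp: fun_eq_iff prefix_op_def split: list.splits)
qed

text \<open>A series is determined by its value at \<open>[]\<close> and its left derivatives. At
  \<open>[]\<close> the identity is that of \<open>P\<close>. The derivative by \<open>{#}\<close>
  undoes \<open>lift_op P\<close>, so on the left the Leibniz rule gives exactly the sum of the
  three arguments of \<open>lift_op P\<close> on the right, the last with weight \<open>lam\<close>.
  Derivatives by nonempty letters vanish on both sides.\<close>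

lemma rota_baxter_lift_op:
  assumes "rota_baxter_op scl mul lam P"
  shows "rota_baxter_op (\<lambda>c f w. scl c (f w)) (qshuffle scl mul lam) lam
     (lift_op P :: ('m multiset list \<Rightarrow> 'a) \<Rightarrow> _)"
proof -
  interpret qs: comm_alg "\<lambda>c f w. scl c (f w)" "qshuffle scl mul lam"
    by (rule comm_alg_qshuffle)
  let ?m = "qshuffle scl mul lam"
  have left_deriv: "left_deriv b (lift_op P f) = (if b = {#} then f else 0)" for f :: "'m multiset list \<Rightarrow> 'a" and b
    by (auto simp add: left_deriv_def lift_op_def)
  have "?m (lift_op P f) (lift_op P g) w =
     lift_op P (?m f (lift_op P g)) w + lift_op P (?m (lift_op P f) g) w
     + scl lam (lift_op P (?m f g) w)" for f g :: "'m multiset list \<Rightarrow> 'a" and w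
  proof (cases w)
    case Nil
    then show ?thesis using assms by (simp add: lift_op_def rota_baxter_op_def)
  next
    case (Cons a v)
    show ?thesis
    proof (cases "a = {#}")
      case True
      then show ?thesis by (simp add: Cons qshuffle_Cons left_deriv lift_op_def[of _ "?m _ _"])
    next
      case False
      \<comment> \<open>A nonempty \<open>a\<close> has at least one nonempty part in every split,
        and the derivative by that part is zero.\<close>
      have "?m (left_deriv b (lift_op P f)) (left_deriv c (lift_op P g)) = 0" if "(b, c) \<in> splits a" for b c
        using that False by (auto simp: splits_def left_deriv simp del: zero_fun_apply)
      then have "(\<Sum>(b, c)\<in>splits a. ?m (left_deriv b (lift_op P f)) (left_deriv c (lift_op P g)) v) = 0"
        by (intro sum.neutral) auto
      then show ?thesis using False
        by (simp add: Cons qshuffle_Cons lift_op_def[of _ "?m _ _"])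
          (simp add: left_deriv del: zero_fun_apply, simp)
    qed
  qed
  then show ?thesis
    using assms unfolding rota_baxter_op_def
    by (auto simp: fun_eq_iff lift_op_def split: list.splits)
qed

end
end

section \<open>The model and linear independence\<close>

lemma (in comm_alg) diff_rota_baxter_algebraI:
  assumes RB: "rota_baxter_op scl mul lam P"
    and D: "\<And>x y. D (x + y) = D x + D y" "\<And>c x. D (scl c x) = scl c (D x)"
      "\<And>x y. D (mul x y) = mul (D x) y + mul x (D y) + scl lam (mul (D x) (D y))"
    and DP: "\<And>x. D (P x) = x"
  shows "diff_rota_baxter_algebra scalar_ring lam
     \<lparr>carrier = UNIV, mult = mul, one = 0, zero = 0, add = (+), smult = scl, opP = P, opD = D\<rparr>"
    (is "diff_rota_baxter_algebra _ _ ?A")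
proof -
  have "abelian_group ?A"
  proof (rule abelian_groupI)
    show "\<exists>y\<in>carrier ?A. y \<oplus>\<^bsub>?A\<^esub> x = \<zero>\<^bsub>?A\<^esub>" for x
      by (rule bexI[of _ "- x"]) auto
  qed (auto simp: ac_simps)
  then have "Module.module scalar_ring ?A"
    by (intro moduleI cring_scalar_ring)
      (auto simp: scalar_ring_def scl_add_left scl_add_right scl_scl scl_one)
  then show ?thesis
    using RB D DP
    by (auto simp: diff_rota_baxter_algebra_def diff_rota_baxter_algebra_axioms_def
       comm_op_algebra_def comm_op_algebra_axioms_def scalar_ring_def rota_baxter_op_def
       mul_assoc mul_add_left mul_scl_left intro: mul_commute)
qed

text \<open>In \<open>F w a v\<close> the word \<open>w\<close> selects a coefficient of the outer
  series, \<open>a\<close> is the leading tensor factor of that coefficient, and \<open>v\<close>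
  lists the tensor factors under the successive applications of \<open>P\<close>.\<close>

definition mixable_shuffle_model ::
    "'k::{comm_ring, comm_monoid_mult} \<Rightarrow>
     ('k, 'm multiset list \<Rightarrow> 'm multiset \<Rightarrow> 'm multiset list \<Rightarrow> 'k) op_algebra" where
  "mixable_shuffle_model lam =
     \<lparr>carrier = UNIV,
      mult = qshuffle (\<lambda>c f a w. c * f a w) (conv (qshuffle (*) (*) lam)) lam, one = 0, zero = 0, add = (+),
      smult = (\<lambda>c F w a v. c * F w a v), opP = lift_op prefix_op, opD = left_deriv {#}\<rparr>"

lemma comm_alg_scalars: "comm_alg (*) ((*) :: 'k::{comm_ring, comm_monoid_mult} \<Rightarrow> 'k \<Rightarrow> 'k)"
  by unfold_locales (auto simp: algebra_simps)

lemma diff_rota_baxter_mixable_shuffle_model: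
  "diff_rota_baxter_algebra scalar_ring lam (mixable_shuffle_model lam)"
proof -
  interpret K: comm_alg "(*)" "(*) :: 'a \<Rightarrow> 'a \<Rightarrow> 'a" by (rule comm_alg_scalars)
  interpret S: comm_alg "\<lambda>c f w. c * f w" "qshuffle (*) (*) lam" by (rule K.comm_alg_qshuffle)
  interpret R: comm_alg "\<lambda>c f a w. c * f a w" "conv (qshuffle (*) (*) lam)"
    by (rule comm_alg_conv[OF S.comm_alg_axioms])
  interpret H: comm_alg "\<lambda>c F w a v. c * F w a v" "qshuffle (\<lambda>c f a w. c * f a w) (conv (qshuffle (*) (*) lam)) lam"
    by (rule R.comm_alg_qshuffle)
  show ?thesis unfolding mixable_shuffle_model_def
  proof (rule H.diff_rota_baxter_algebraI)
    show "rota_baxter_op (\<lambda>c F w a v. c * F w a v)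
     (qshuffle (\<lambda>c f a w. c * f a w) (conv (qshuffle (*) (*) lam)) lam) lam (lift_op prefix_op)"
      by (rule R.rota_baxter_lift_op) (rule K.rota_baxter_prefix_op)
  qed (auto simp: R.left_deriv_qshuffle, auto simp: left_deriv_def lift_op_def)
qed

section \<open>Basis vectors of the model and the values of words\<close>

definition delta :: "'m multiset \<Rightarrow> 'm multiset list \<Rightarrow> 'm multiset \<Rightarrow> 'm multiset list \<Rightarrow> 'k::{comm_ring, comm_monoid_mult}" where
  "delta a w b v = (if b = a \<and> v = w then 1 else 0)"

lemma prefix_op_delta: "prefix_op (delta b w) = delta {#} (b # w)"
  by (auto simp: prefix_op_def delta_def fun_eq_iff split: list.splits)

text \<open>All left derivatives of the unit series vanish, so the recursion hands every letter to
  \<open>g\<close>.\<close>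

lemma (in comm_alg) qshuffle_unit:
  assumes "\<And>x. mul e x = x"
  shows "qshuffle scl mul lam (\<lambda>v. if v = [] then e else 0) g = g"
proof
  fix w show "qshuffle scl mul lam (\<lambda>v. if v = [] then e else 0) g w = g w"
  proof (induction w arbitrary: g)
    case Nil
    then show ?case by (simp add: assms)
  next
    case (Cons a w)
    have left_deriv: "left_deriv a (\<lambda>v. if v = [] then e else 0) = 0" for a :: "'m multiset"
      by (auto simp: left_deriv_def)
    show ?case
      by (simp add: qshuffle_Cons left_deriv qshuffle_zero_left Cons case_prod_beta del: zero_fun_apply)
        (simp add: left_deriv_def)
  qed
qed

text \<open>Evaluating a word of \<open>\<Upsilon> X\<close> multiplies only by factors from
  \<open>CS (D_omega X)\<close>, whose vectors have an empty tail. Such a tail is a unit for the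
  quasi-shuffle, so only leading factors are combined and no genuine shuffle has to be
  computed.\<close>

lemma conv_delta:
  fixes lam :: "'k::{comm_ring, comm_monoid_mult}" and a b :: "'m multiset"
  shows "conv (qshuffle (*) (*) lam) (delta a []) (delta b w) = delta (a + b) w"
proof -
  interpret K: comm_alg "(*)" "(*) :: 'k \<Rightarrow> 'k \<Rightarrow> 'k" by (rule comm_alg_scalars)
  interpret S: comm_alg "\<lambda>c f w. c * f w" "qshuffle (*) (*) lam" by (rule K.comm_alg_qshuffle)
  have "(delta a [] a :: 'm multiset list \<Rightarrow> 'k) = (\<lambda>v. if v = [] then 1 else 0)" for a
    by (simp add: delta_def fun_eq_iff)
  then have "qshuffle (*) (*) lam (delta a [] a) (delta b w b) = delta b w b"
    by (simp add: K.qshuffle_unit)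
  then have "conv (qshuffle (*) (*) lam) (delta a []) (delta b w) c
      = (if c = a + b then delta b w b else 0)" for c
    by (subst S.conv_single[where a = a and b = b]) (auto simp: delta_def)
  then show ?thesis
    by (auto simp: fun_eq_iff delta_def)
qed

text \<open>Each application of \<open>D\<close> evaluates one letter further out, so the length of
  \<open>w\<close> counts derivatives: the constant term of the \<open>i\<close>-th derivative of
  \<open>x\<close> is the variable \<open>(i, x)\<close>.\<close>

definition shuffle_generator :: "'x \<Rightarrow> (nat \<times> 'x) multiset list \<Rightarrow> (nat \<times> 'x) multiset
    \<Rightarrow> (nat \<times> 'x) multiset list \<Rightarrow> 'k::{comm_ring, comm_monoid_mult}" where
  "shuffle_generator x w = delta {#(length w, x)#} []"

definition D_omega_word :: "(nat \<times> 'x) multiset \<Rightarrow> 'x word" where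
  "D_omega_word a = image_mset (\<lambda>(i, x). D_power i x) a"

text \<open>Recovers a word from the index of its basis vector. A left inverse gives injectivity at
  once, with no comparison of the shapes of words and no injectivity of
  \<open>D_power\<close>.\<close>

primrec decode :: "(nat \<times> 'x) multiset list \<Rightarrow> (nat \<times> 'x) multiset \<Rightarrow> 'x word" where
  "decode [] a = D_omega_word a"
| "decode (b # w) a = D_omega_word a + {#LP (decode w b)#}"

lemma mixable_shuffle_model_simps [simp]:
  "carrier (mixable_shuffle_model lam) = UNIV"
  "\<zero>\<^bsub>mixable_shuffle_model lam\<^esub> = 0"
  "F \<oplus>\<^bsub>mixable_shuffle_model lam\<^esub> G = F + G"
  "(F \<otimes>\<^bsub>mixable_shuffle_model lam\<^esub> G) [] = conv (qshuffle (*) (*) lam) (F []) (G [])"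
  "c \<odot>\<^bsub>mixable_shuffle_model lam\<^esub> F = (\<lambda>w a v. c * F w a v)"
  "opP (mixable_shuffle_model lam) F [] = prefix_op (F [])"
  "opD (mixable_shuffle_model lam) F w = F ({#} # w)"
  by (simp_all add: mixable_shuffle_model_def lift_op_def left_deriv_def)

lemma finsum_mixable_shuffle_model:
  "finite F \<Longrightarrow> (\<Oplus>\<^bsub>mixable_shuffle_model lam\<^esub>i\<in>F. g i) = (\<Sum>i\<in>F. g i)"
proof (induction F rule: finite_induct)
  interpret diff_rota_baxter_algebra scalar_ring lam "mixable_shuffle_model lam"
    by (rule diff_rota_baxter_mixable_shuffle_model)
  {
    case empty
    show ?case by simp
  next
    case (insert i F)
    then show ?case by (subst M.finsum_insert) auto
  }
qed

context
  fixes lam :: "'k::{comm_ring, comm_monoid_mult}" and X :: "'x set"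
begin

interpretation diff_rota_baxter_algebra scalar_ring lam "mixable_shuffle_model lam"
  by (rule diff_rota_baxter_mixable_shuffle_model)

lemma shuffle_generator_Pi: "shuffle_generator \<in> X \<rightarrow> carrier (mixable_shuffle_model lam)"
  by simp

abbreviation "\<mu> \<equiv> eval_word (mixable_shuffle_model lam) shuffle_generator"

text \<open>Arbitrary \<open>w\<close> is needed for the induction, since one more \<open>D\<close>
  replaces \<open>w\<close> by \<open>{#} # w\<close>.\<close>

lemma eval_model_D_power:
  "x \<in> X \<Longrightarrow> \<mu> {#D_power i x#} w = delta {#(i + length w, x)#} []"
proof (induction i arbitrary: w)
  case 0
  then show ?case
    by (simp add: D_power_def eval_word_Gen[OF shuffle_generator_Pi]) (simp add: shuffle_generator_def)
next
  case (Suc i)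
  then show ?case
    by (simp add: D_power_Suc eval_word_LD[OF shuffle_generator_Pi D_power_Q])
qed

lemma eval_model_base:
  "u \<in> CS (D_omega X) \<Longrightarrow> \<exists>a. D_omega_word a = u \<and> \<mu> u [] = delta a []"
proof (induction rule: CS_induct)
  case (single y)
  then obtain i x where "x \<in> X" "y = D_power i x" by (auto simp: D_omega_def)
  then show ?case
    by (intro exI[of _ "{#(i, x)#}"]) (simp add: eval_model_D_power D_omega_word_def)
next
  case (add y v)
  then obtain i x where y: "x \<in> X" "y = D_power i x" by (auto simp: D_omega_def)
  obtain a where a: "D_omega_word a = v" "\<mu> v [] = delta a []" using add by blast
  have "\<mu> ({#y#} + v) = \<mu> {#y#} \<otimes>\<^bsub>mixable_shuffle_model lam\<^esub> \<mu> v"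
    by (rule eval_word_add[OF shuffle_generator_Pi]) (use add y in \<open>simp_all add: D_power_Q CS_D_omega_Q\<close>)
  then have "\<mu> ({#y#} + v) [] = delta ({#(i, x)#} + a) []"
    using y by (simp only: mixable_shuffle_model_simps a(2) eval_model_D_power y) (simp add: conv_delta)
  moreover have "D_omega_word ({#(i, x)#} + a) = {#y#} + v"
    using a y by (simp add: D_omega_word_def)
  ultimately show ?case by blast
qed

text \<open>Constant terms suffice: they are compatible with products and with \<open>P\<close>, and
  in these words \<open>D\<close> is applied only inside the letters of \<open>D_omega X\<close>,
  already settled by \<open>eval_model_D_power\<close>.\<close>

lemma eval_model_Upsilon_level:
  "w \<in> \<Upsilon>_level X n \<Longrightarrow> \<exists>a v. decode v a = w \<and> \<mu> w [] = delta a v"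
proof (induction n arbitrary: w)
  case 0
  then obtain a where "D_omega_word a = w" "\<mu> w [] = delta a []"
    using eval_model_base[of w] by auto
  then show ?case by (intro exI[of _ a] exI[of _ "[]"]) simp
next
  case (Suc n)
  have LP: "\<exists>b v. decode v b = u \<and> \<mu> {#LP u#} [] = delta {#} (b # v)" and Q: "{#LP u#} \<in> \<Q> X" if "u \<in> \<Upsilon>_level X n" for u
  proof -
    have u: "u \<in> \<Q> X" using that Upsilon_Q[of X] by (auto simp: \<Upsilon>_def)
    then show "{#LP u#} \<in> \<Q> X" by (rule Q_LP)
    obtain b v where "decode v b = u" "\<mu> u [] = delta b v" using Suc.IH \<open>u \<in> \<Upsilon>_level X n\<close> by blast
    then show "\<exists>b v. decode v b = u \<and> \<mu> {#LP u#} [] = delta {#} (b # v)"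
      by (intro exI[of _ b] exI[of _ v]) (simp add: eval_word_LP[OF shuffle_generator_Pi u] prefix_op_delta)
  qed
  from Suc.prems show ?case
  proof (cases rule: Upsilon_level_cases)
    case base
    then obtain a where "D_omega_word a = w" "\<mu> w [] = delta a []"
      using eval_model_base[of w] by auto
    then show ?thesis by (intro exI[of _ a] exI[of _ "[]"]) simp
  next
    case (P m u)
    then obtain b v where "decode v b = u" "\<mu> {#LP u#} [] = delta {#} (b # v)"
      using LP[of u] by auto
    \<comment> \<open>A bare \<open>P(u)\<close> has the empty commutative word as its leading
      factor.\<close>
    then show ?thesis using P
      by (intro exI[of _ "{#}"] exI[of _ "b # v"]) (simp add: D_omega_word_def)
  next
    case (mult m a' u)
    then obtain b v where v: "decode v b = u" "\<mu> {#LP u#} [] = delta {#} (b # v)"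
      using LP[of u] by auto
    obtain a where a: "D_omega_word a = a'" "\<mu> a' [] = delta a []"
      using eval_model_base mult by blast
    have "\<mu> w = \<mu> a' \<otimes>\<^bsub>mixable_shuffle_model lam\<^esub> \<mu> {#LP u#}"
      unfolding mult(4)
      by (rule eval_word_add[OF shuffle_generator_Pi]) (use mult Q in \<open>simp_all add: CS_D_omega_Q\<close>)
    then have "\<mu> w [] = delta a (b # v)"
      by (simp only: mixable_shuffle_model_simps a v) (simp add: conv_delta)
    then show ?thesis using v a mult
      by (intro exI[of _ a] exI[of _ "b # v"]) simp
  qed
qed

lemma eval_model_Upsilon:
  obtains code where "\<And>w. w \<in> \<Upsilon> X \<Longrightarrow> \<mu> w [] = delta (fst (code w)) (snd (code w))"
    and "inj_on code (\<Upsilon> X)"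
proof -
  have "\<forall>w\<in>\<Upsilon> X. \<exists>av. decode (snd av) (fst av) = w \<and> \<mu> w [] = delta (fst av) (snd av)"
  proof
    fix w assume "w \<in> \<Upsilon> X"
    then obtain n where "w \<in> \<Upsilon>_level X n" by (auto simp: \<Upsilon>_def)
    then obtain a v where "decode v a = w" "\<mu> w [] = delta a v"
      using eval_model_Upsilon_level by blast
    then show "\<exists>av. decode (snd av) (fst av) = w \<and> \<mu> w [] = delta (fst av) (snd av)"
      by (intro exI[of _ "(a, v)"]) simp
  qed
  then obtain code where "\<forall>w\<in>\<Upsilon> X. decode (snd (code w)) (fst (code w)) = w \<and> \<mu> w [] = delta (fst (code w)) (snd (code w))"
    by metis
  then show ?thesis
    by (intro that[of code]) (auto intro: inj_on_inverseI[where g = "\<lambda>av. decode (snd av) (fst av)"])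
qed

end

section \<open>Linear independence in the quotient\<close>

context drb_presentation begin

text \<open>A vanishing combination of classes comes from an element of the ideal, which evaluates
  to zero in the model. Reading off the coefficient of the basis vector that belongs to
  \<open>j\<close> isolates \<open>c j\<close>; no cancellation in \<open>K\<close> is used.\<close>

lemma Upsilon_independent:
  assumes F: "finite G" "G \<subseteq> \<Upsilon> X" and 0: "(\<Oplus>\<^bsub>B\<^esub>i\<in>G. c i \<odot>\<^bsub>B\<^esub> word_class lam X i) = \<zero>\<^bsub>B\<^esub>"
    and j: "j \<in> G"
  shows "c j = 0"
proof -
  let ?M = "mixable_shuffle_model lam :: ('k, (nat \<times> 'x) multiset list \<Rightarrow> _) op_algebra"
  interpret S: diff_rota_baxter_algebra scalar_ring lam ?M
    by (rule diff_rota_baxter_mixable_shuffle_model)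
  interpret S: scalar_op_algebra ?M by unfold_locales
  let ?e = "eval_word ?M shuffle_generator"
  have gen: "shuffle_generator \<in> X \<rightarrow> carrier ?M" by simp
  define p where "p = (\<Sum>i\<in>G. Poly_Mapping.single i (c i))"
  have p: "Poly_Mapping.lookup p i = (if i \<in> G then c i else 0)" for i
    using F by (auto simp: p_def Poly_Mapping.lookup_sum Poly_Mapping.lookup_single when_def)
  then have keys: "Poly_Mapping.keys p \<subseteq> G" by (auto simp: Poly_Mapping.in_keys_iff split: if_splits)
  have G: "G \<subseteq> \<Q> X" using F Upsilon_Q by blast
  have "\<pi> p = (\<Oplus>\<^bsub>B\<^esub>i\<in>G. Poly_Mapping.lookup p i \<odot>\<^bsub>B\<^esub> \<xi> i)"
    using keys G by (simp add: pi_lincomb lincomb_superset[OF eval_word_Pi[OF eta_closed] F(1)])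
  also have "\<dots> = (\<Oplus>\<^bsub>B\<^esub>i\<in>G. c i \<odot>\<^bsub>B\<^esub> word_class lam X i)"
    using G eval_word_closed[OF eta_closed] by (intro M.finsum_cong') (auto simp: p word_class_eval subset_iff)
  finally have "\<pi> p = I" using 0 by (simp add: drb_quotient_def op_quotient_def)
  then have "p \<in> I"
    using comm_op_algebra.coset_eq_zero_iff[OF comm_op_algebra_free op_ideal_I, of p] keys G by auto
  then have "lincomb ?M ?e p = 0"
    using lincomb_eval_word_drb_ideal[OF diff_rota_baxter_mixable_shuffle_model gen] by auto
  then have "(\<Sum>i\<in>G. (\<lambda>w a v. Poly_Mapping.lookup p i * ?e i w a v)) = 0"
    using S.lincomb_superset[OF S.eval_word_Pi[OF gen] F(1) keys G]
    by (simp add: finsum_mixable_shuffle_model F)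
  then have *: "(\<Sum>i\<in>G. c i * ?e i [] a v) = 0" for a v
    by (simp add: fun_eq_iff sum_fun_apply p)
  obtain code where code: "\<And>w. w \<in> \<Upsilon> X \<Longrightarrow> ?e w [] = delta (fst (code w)) (snd (code w))"
      "inj_on code (\<Upsilon> X)"
    using eval_model_Upsilon by blast
  \<comment> \<open>Injectivity of \<open>code\<close> makes every other word of \<open>G\<close>
    contribute zero at the index of \<open>j\<close>.\<close>
  have "c i * ?e i [] (fst (code j)) (snd (code j)) = (if i = j then c j else 0)" if "i \<in> G" for i
  proof -
    have "i \<in> \<Upsilon> X" "j \<in> \<Upsilon> X" using that F j by auto
    then show ?thesis
      using code(1)[of i] inj_onD[OF code(2), of i j] by (auto simp: delta_def prod_eq_iff)
  qed
  then have "(\<Sum>i\<in>G. c i * ?e i [] (fst (code j)) (snd (code j))) = (\<Sum>i\<in>G. if i = j then c j else 0)"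
    by (rule sum.cong[OF refl])
  then show ?thesis using * j F by simp
qed

end

theorem theorem6p3:
  fixes lam :: "'k::{comm_ring, comm_monoid_mult}" and X :: "'x set"
  shows "free_diff_rota_baxter_algebra TYPE('r) scalar_ring lam X (drb_quotient lam X)
           (\<lambda>x. word_class lam X {#Gen x#})
       \<and> basis_family scalar_ring (drb_quotient lam X) (\<Upsilon> X) (word_class lam X)"
proof (intro conjI)
  interpret drb_presentation lam X .
  show "free_diff_rota_baxter_algebra TYPE('r) scalar_ring lam X B \<eta>"
    unfolding free_diff_rota_baxter_algebra_def
    by (intro conjI allI impI diff_rota_baxter_algebra_B eta_closed) (elim conjE, rule ex1_hom)
  have closed: "word_class lam X \<in> \<Upsilon> X \<rightarrow> carrier B"
  proof
    fix w assume "w \<in> \<Upsilon> X"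
    then have "w \<in> \<Q> X" using Upsilon_Q by blast
    then show "word_class lam X w \<in> carrier B"
      by (simp add: word_class_eval eval_word_closed[OF eta_closed])
  qed
  show "basis_family scalar_ring B (\<Upsilon> X) (word_class lam X)"
    unfolding basis_family_def
  proof (intro conjI allI impI ballI closed)
    show "c i = \<zero>\<^bsub>scalar_ring\<^esub>"
      if "finite G \<and> G \<subseteq> \<Upsilon> X \<and> c \<in> G \<rightarrow> carrier scalar_ring \<and> (\<Oplus>\<^bsub>B\<^esub>i\<in>G. c i \<odot>\<^bsub>B\<^esub> word_class lam X i) = \<zero>\<^bsub>B\<^esub>"
        and "i \<in> G" for G c i
      using that Upsilon_independent[of G c i] by simp
    fix a assume "a \<in> carrier B"
    then obtain q where "Poly_Mapping.keys q \<subseteq> \<Upsilon> X" "a = lincomb B (word_class lam X) q"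
      using span_Upsilon by blast
    then show "\<exists>G c. finite G \<and> G \<subseteq> \<Upsilon> X \<and> c \<in> G \<rightarrow> carrier scalar_ring \<and> a = (\<Oplus>\<^bsub>B\<^esub>i\<in>G. c i \<odot>\<^bsub>B\<^esub> word_class lam X i)"
      by (intro exI[of _ "Poly_Mapping.keys q"] exI[of _ "Poly_Mapping.lookup q"]) (simp add: lincomb_def)
  qed
qed

end
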